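(* Let $\Lambda\in\{\mathsf{IS4},\mathsf{S4I},\mathsf{GS4},\mathsf{GS4^c}\}$. For every set of formulas $\Gamma$ and every formula $\varphi$ of $\mathcal L$, $\Gamma\models_\Lambda\varphi$ if and only if $\Gamma\vdash_\Lambda\varphi$.
   Context: Fix a countably infinite set $\mathbb P$ of propositional variables. The language $\mathcal L$: $\varphi ::= p \mid \bot \mid (\varphi\wedge\varphi)\mid(\varphi\vee\varphi)\mid(\varphi\to\varphi)\mid\Diamond\varphi\mid\Box\varphi$, $p\in\mathbb P$; $\neg\varphi:=\varphi\to\bot$. A logic is a set of formulas closed under substitution. Logics: $\mathsf{CS4}$ is the smallest logic containing all intuitionistic propositional tautologies (in $\mathcal L$) and the axioms $\Box(p\to q)\to(\Box p\to\Box q)$, $\Box(p\to q)\to(\Diamond p\to\Diamond q)$, $\Box p\to p$, $p\to\Diamond p$, $\Diamond\Diamond p\to\Diamond p$, $\Box p\to\Box\Box p$, closed under modus ponens and necessitation. Let DP $=\Diamond(p\vee q)\to\Diamond p\vee\Diamond q$, N $=\neg\Diamond\bot$, FS2 $=(\Diamond p\to\Box q)\to\Box(p\to q)$, CD $=\Box(p\vee q)\to\Box p\vee\Diamond q$, GD $=(p\to q)\vee(q\to p)$. Then $\mathsf{IS4}=\mathsf{CS4}+$DP$+$N$+$FS2, $\mathsf{S4I}=\mathsf{CS4}+$DP$+$N$+$CD, $\mathsf{GS4}=\mathsf{IS4}+$GD, $\mathsf{GS4^c}=\mathsf{GS4}+$CD, where $+$ means the smallest logic containing the given logic and axioms and closed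 under modus ponens and necessitation. Syntactic consequence: $\Gamma\vdash_\Lambda\varphi$ iff $\bigwedge\Gamma'\to\varphi\in\Lambda$ for some finite $\Gamma'\subseteq\Gamma$. Frames: a bi-intuitionistic frame $(W,W^\bot,\preccurlyeq,\sqsubseteq)$ has preorders $\preccurlyeq,\sqsubseteq$ on $W$ and $W^\bot\subseteq W$ closed upward under both; infallible if $W^\bot=\varnothing$. Forth--up confluent: $w\preccurlyeq w'$, $w\sqsubseteq v$ imply some $v'$ with $v\preccurlyeq v'$, $w'\sqsubseteq v'$. Back--up confluent: $w\sqsubseteq v\preccurlyeq v'$ implies some $w'$ with $w\preccurlyeq w'\sqsubseteq v'$. Forth--down confluent: $w\preccurlyeq v\sqsubseteq v'$ implies some $w'$ with $w\sqsubseteq w'\preccurlyeq v'$. Upward linear: $w\preccurlyeq u,w\preccurlyeq v$ imply $u\preccurlyeq v$ or $v\preccurlyeq u$. $\mathsf{IS4}$ frames: infallible, forth--up and back--up confluent. $\mathsf{S4I}$ frames: infallible, forth--up and forth--down confluent. $\mathsf{GS4}$ frames: upward linear $\mathsf{IS4}$ frames. $\mathsf{GS4^c}$ frames: forth--down confluent $\mathsf{GS4}$ frames. Valuations $V:\mathbb P\to2^W$ have each $V(p)$ $\preccurlyeq$-upward closed and containing $W^\bot$. Satisfaction: $w\models p$ iff $w\in V(p)$; $w\models\bot$ iff $w\in W^\bot$; $\wedge,\vee$ pointwise; $w\models\varphi\to\psi$ iff for all $v\succcurlyeq w$, $v\models\varphi$ implies $v\models\psi$; $w\models\Diamond\varphi$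 iff for all $u\succcurlyeq w$ there is $v\sqsupseteq u$ with $v\models\varphi$; $w\models\Box\varphi$ iff for all $u,v$ with $w\preccurlyeq u\sqsubseteq v$, $v\models\varphi$. Local semantic consequence: $\Gamma\models_\Lambda\varphi$ iff for every model (frame plus valuation) on a $\Lambda$ frame and every world $w\notin W^\bot$, if $w\models\psi$ for all $\psi\in\Gamma$ then $w\models\varphi$. *)

theory Defs
  imports Main "HOL-Library.Countable" "HOL-Library.Infinite_Typeclass"
begin

section \<open>Formulas\<close>

datatype 'p fm =
    Var 'p
  | Bot  ("\<^bold>\<bottom>")
  | And "'p fm" "'p fm"  (infixr "\<^bold>\<and>" 65)
  | Or "'p fm" "'p fm"   (infixr "\<^bold>\<or>" 60)
  | Imp "'p fm" "'p fm"  (infixr "\<^bold>\<rightarrow>" 55)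
  | Dia "'p fm"  ("\<^bold>\<diamond> _" [80] 80)
  | Box "'p fm"  ("\<^bold>\<box> _" [80] 80)

abbreviation Neg :: "'p fm \<Rightarrow> 'p fm"  ("\<^bold>\<not> _" [80] 80)
  where "\<^bold>\<not> \<phi> \<equiv> \<phi> \<^bold>\<rightarrow> \<^bold>\<bottom>"

primrec subst :: "('p \<Rightarrow> 'p fm) \<Rightarrow> 'p fm \<Rightarrow> 'p fm" where
  "subst \<sigma> (Var p) = \<sigma> p"
| "subst \<sigma> \<^bold>\<bottom> = \<^bold>\<bottom>"
| "subst \<sigma> (\<phi> \<^bold>\<and> \<psi>) = subst \<sigma> \<phi> \<^bold>\<and> subst \<sigma> \<psi>"
| "subst \<sigma> (\<phi> \<^bold>\<or> \<psi>) = subst \<sigma> \<phi> \<^bold>\<or> subst \<sigma> \<psi>"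
| "subst \<sigma> (\<phi> \<^bold>\<rightarrow> \<psi>) = (subst \<sigma> \<phi> \<^bold>\<rightarrow> subst \<sigma> \<psi>)"
| "subst \<sigma> (\<^bold>\<diamond> \<phi>) = \<^bold>\<diamond> (subst \<sigma> \<phi>)"
| "subst \<sigma> (\<^bold>\<box> \<phi>) = \<^bold>\<box> (subst \<sigma> \<phi>)"


section \<open>Logics\<close>

text \<open>Intuitionistic propositional tautologies of the full modal language, by a standard Hilbert
  calculus: the schemes range over all formulas, so modal formulas behave as atoms.\<close>

inductive_set IPC :: "'p fm set" where
  ax_K: "(\<phi> \<^bold>\<rightarrow> \<psi> \<^bold>\<rightarrow> \<phi>) \<in> IPC"
| ax_S: "((\<phi> \<^bold>\<rightarrow> \<psi> \<^bold>\<rightarrow> \<chi>) \<^bold>\<rightarrow> (\<phi> \<^bold>\<rightarrow> \<psi>) \<^bold>\<rightarrow> \<phi> \<^bold>\<rightarrow> \<chi>) \<in> IPC"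
| conj_elim1: "(\<phi> \<^bold>\<and> \<psi> \<^bold>\<rightarrow> \<phi>) \<in> IPC"
| conj_elim2: "(\<phi> \<^bold>\<and> \<psi> \<^bold>\<rightarrow> \<psi>) \<in> IPC"
| conj_intro: "(\<phi> \<^bold>\<rightarrow> \<psi> \<^bold>\<rightarrow> \<phi> \<^bold>\<and> \<psi>) \<in> IPC"
| disj_intro1: "(\<phi> \<^bold>\<rightarrow> \<phi> \<^bold>\<or> \<psi>) \<in> IPC"
| disj_intro2: "(\<psi> \<^bold>\<rightarrow> \<phi> \<^bold>\<or> \<psi>) \<in> IPC"
| disj_elim: "((\<phi> \<^bold>\<rightarrow> \<chi>) \<^bold>\<rightarrow> (\<psi> \<^bold>\<rightarrow> \<chi>) \<^bold>\<rightarrow> \<phi> \<^bold>\<or> \<psi> \<^bold>\<rightarrow> \<chi>) \<in> IPC"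
| ex_falso: "(\<^bold>\<bottom> \<^bold>\<rightarrow> \<phi>) \<in> IPC"
| mp: "(\<phi> \<^bold>\<rightarrow> \<psi>) \<in> IPC \<Longrightarrow> \<phi> \<in> IPC \<Longrightarrow> \<psi> \<in> IPC"

definition is_logic :: "'p fm set \<Rightarrow> bool" where
  "is_logic L \<longleftrightarrow> (\<forall>\<sigma> \<phi>. \<phi> \<in> L \<longrightarrow> subst \<sigma> \<phi> \<in> L)"

definition mp_closed :: "'p fm set \<Rightarrow> bool" where
  "mp_closed L \<longleftrightarrow> (\<forall>\<phi> \<psi>. (\<phi> \<^bold>\<rightarrow> \<psi>) \<in> L \<longrightarrow> \<phi> \<in> L \<longrightarrow> \<psi> \<in> L)"

definition nec_closed :: "'p fm set \<Rightarrow> bool" where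
  "nec_closed L \<longleftrightarrow> (\<forall>\<phi>. \<phi> \<in> L \<longrightarrow> \<^bold>\<box> \<phi> \<in> L)"

definition extend :: "'p fm set \<Rightarrow> 'p fm set \<Rightarrow> 'p fm set"  (infixl "\<^bold>+" 65) where
  "L \<^bold>+ A = \<Inter>{L'. is_logic L' \<and> mp_closed L' \<and> nec_closed L' \<and> L \<subseteq> L' \<and> A \<subseteq> L'}"

text \<open>An axiom in propositional variables \<open>p\<close>, \<open>q\<close> is represented by the set of its
  variants for all choices of distinct variables; these are renamings of one another, and logics
  are closed under substitution.\<close>

definition CS4_axioms :: "'p fm set" where
  "CS4_axioms =
     {\<^bold>\<box> (Var p \<^bold>\<rightarrow> Var q) \<^bold>\<rightarrow> \<^bold>\<box> (Var p) \<^bold>\<rightarrow> \<^bold>\<box> (Var q) | p q. p \<noteq> q}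
   \<union> {\<^bold>\<box> (Var p \<^bold>\<rightarrow> Var q) \<^bold>\<rightarrow> \<^bold>\<diamond> (Var p) \<^bold>\<rightarrow> \<^bold>\<diamond> (Var q) | p q. p \<noteq> q}
   \<union> {\<^bold>\<box> (Var p) \<^bold>\<rightarrow> Var p | p. True}
   \<union> {Var p \<^bold>\<rightarrow> \<^bold>\<diamond> (Var p) | p. True}
   \<union> {\<^bold>\<diamond> (\<^bold>\<diamond> (Var p)) \<^bold>\<rightarrow> \<^bold>\<diamond> (Var p) | p. True}
   \<union> {\<^bold>\<box> (Var p) \<^bold>\<rightarrow> \<^bold>\<box> (\<^bold>\<box> (Var p)) | p. True}"

definition DP :: "'p fm set" where
  "DP = {\<^bold>\<diamond> (Var p \<^bold>\<or> Var q) \<^bold>\<rightarrow> \<^bold>\<diamond> (Var p) \<^bold>\<or> \<^bold>\<diamond> (Var q) | p q. p \<noteq> q}"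

definition N :: "'p fm set" where
  "N = {\<^bold>\<not> (\<^bold>\<diamond> \<^bold>\<bottom>)}"

definition FS2 :: "'p fm set" where
  "FS2 = {(\<^bold>\<diamond> (Var p) \<^bold>\<rightarrow> \<^bold>\<box> (Var q)) \<^bold>\<rightarrow> \<^bold>\<box> (Var p \<^bold>\<rightarrow> Var q) | p q. p \<noteq> q}"

definition CD :: "'p fm set" where
  "CD = {\<^bold>\<box> (Var p \<^bold>\<or> Var q) \<^bold>\<rightarrow> \<^bold>\<box> (Var p) \<^bold>\<or> \<^bold>\<diamond> (Var q) | p q. p \<noteq> q}"

definition GD :: "'p fm set" where
  "GD = {(Var p \<^bold>\<rightarrow> Var q) \<^bold>\<or> (Var q \<^bold>\<rightarrow> Var p) | p q. p \<noteq> q}"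

definition CS4 :: "'p fm set" where "CS4 = IPC \<^bold>+ CS4_axioms"
definition IS4 :: "'p fm set" where "IS4 = CS4 \<^bold>+ (DP \<union> N \<union> FS2)"
definition S4I :: "'p fm set" where "S4I = CS4 \<^bold>+ (DP \<union> N \<union> CD)"
definition GS4 :: "'p fm set" where "GS4 = IS4 \<^bold>+ GD"
definition GS4c :: "'p fm set" where "GS4c = GS4 \<^bold>+ CD"

datatype logic_name = Name_IS4 | Name_S4I | Name_GS4 | Name_GS4c

primrec logic_of :: "logic_name \<Rightarrow> 'p fm set" where
  "logic_of Name_IS4 = IS4"
| "logic_of Name_S4I = S4I"
| "logic_of Name_GS4 = GS4"
| "logic_of Name_GS4c = GS4c"

text \<open>The conjunction of a finite set is taken along a list enumerating it; the empty conjunction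
  is \<open>\<^bold>\<bottom> \<^bold>\<rightarrow> \<^bold>\<bottom>\<close>.\<close>

definition Conj :: "'p fm list \<Rightarrow> 'p fm" where
  "Conj \<psi>s = foldr And \<psi>s (\<^bold>\<not> \<^bold>\<bottom>)"

definition syn_conseq :: "logic_name \<Rightarrow> 'p fm set \<Rightarrow> 'p fm \<Rightarrow> bool" where
  "syn_conseq \<Lambda> \<Gamma> \<phi> \<longleftrightarrow> (\<exists>\<psi>s. set \<psi>s \<subseteq> \<Gamma> \<and> (Conj \<psi>s \<^bold>\<rightarrow> \<phi>) \<in> logic_of \<Lambda>)"


section \<open>Frames and models\<close>

record 'w frame =
  worlds :: "'w set"
  fallible :: "'w set"
  ile :: "('w \<times> 'w) set"  \<comment> \<open>the intuitionistic order\<close>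
  mle :: "('w \<times> 'w) set"  \<comment> \<open>the modal order\<close>

definition bi_intuitionistic_frame :: "'w frame \<Rightarrow> bool" where
  "bi_intuitionistic_frame F \<longleftrightarrow>
     preorder_on (worlds F) (ile F) \<and> preorder_on (worlds F) (mle F) \<and>
     fallible F \<subseteq> worlds F \<and>
     (\<forall>w v. w \<in> fallible F \<longrightarrow> (w, v) \<in> ile F \<longrightarrow> v \<in> fallible F) \<and>
     (\<forall>w v. w \<in> fallible F \<longrightarrow> (w, v) \<in> mle F \<longrightarrow> v \<in> fallible F)"

definition infallible :: "'w frame \<Rightarrow> bool" where
  "infallible F \<longleftrightarrow> fallible F = {}"

definition forth_up_confluent :: "'w frame \<Rightarrow> bool" where
  "forth_up_confluent F \<longleftrightarrow>
     (\<forall>w w' v. (w, w') \<in> ile F \<longrightarrow> (w, v) \<in> mle F \<longrightarrow> (\<exists>v'. (v, v') \<in> ile F \<and> (w', v') \<in> mle F))"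

definition back_up_confluent :: "'w frame \<Rightarrow> bool" where
  "back_up_confluent F \<longleftrightarrow>
     (\<forall>w v v'. (w, v) \<in> mle F \<longrightarrow> (v, v') \<in> ile F \<longrightarrow> (\<exists>w'. (w, w') \<in> ile F \<and> (w', v') \<in> mle F))"

definition forth_down_confluent :: "'w frame \<Rightarrow> bool" where
  "forth_down_confluent F \<longleftrightarrow>
     (\<forall>w v v'. (w, v) \<in> ile F \<longrightarrow> (v, v') \<in> mle F \<longrightarrow> (\<exists>w'. (w, w') \<in> mle F \<and> (w', v') \<in> ile F))"

definition upward_linear :: "'w frame \<Rightarrow> bool" where
  "upward_linear F \<longleftrightarrow>
     (\<forall>w u v. (w, u) \<in> ile F \<longrightarrow> (w, v) \<in> ile F \<longrightarrow> (u, v) \<in> ile F \<or> (v, u) \<in> ile F)"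

definition IS4_frame :: "'w frame \<Rightarrow> bool" where
  "IS4_frame F \<longleftrightarrow>
     bi_intuitionistic_frame F \<and> infallible F \<and> forth_up_confluent F \<and> back_up_confluent F"

definition S4I_frame :: "'w frame \<Rightarrow> bool" where
  "S4I_frame F \<longleftrightarrow>
     bi_intuitionistic_frame F \<and> infallible F \<and> forth_up_confluent F \<and> forth_down_confluent F"

definition GS4_frame :: "'w frame \<Rightarrow> bool" where
  "GS4_frame F \<longleftrightarrow> IS4_frame F \<and> upward_linear F"

definition GS4c_frame :: "'w frame \<Rightarrow> bool" where
  "GS4c_frame F \<longleftrightarrow> GS4_frame F \<and> forth_down_confluent F"

primrec frame_for :: "logic_name \<Rightarrow> 'w frame \<Rightarrow> bool" where
  "frame_for Name_IS4 = IS4_frame"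
| "frame_for Name_S4I = S4I_frame"
| "frame_for Name_GS4 = GS4_frame"
| "frame_for Name_GS4c = GS4c_frame"

definition valuation :: "'w frame \<Rightarrow> ('p \<Rightarrow> 'w set) \<Rightarrow> bool" where
  "valuation F V \<longleftrightarrow>
     (\<forall>p. fallible F \<subseteq> V p \<and> V p \<subseteq> worlds F \<and>
          (\<forall>w v. w \<in> V p \<longrightarrow> (w, v) \<in> ile F \<longrightarrow> v \<in> V p))"

primrec sat :: "'w frame \<Rightarrow> ('p \<Rightarrow> 'w set) \<Rightarrow> 'w \<Rightarrow> 'p fm \<Rightarrow> bool" where
  "sat F V w (Var p) \<longleftrightarrow> w \<in> V p"
| "sat F V w \<^bold>\<bottom> \<longleftrightarrow> w \<in> fallible F"
| "sat F V w (\<phi> \<^bold>\<and> \<psi>) \<longleftrightarrow> sat F V w \<phi> \<and> sat F V w \<psi>"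
| "sat F V w (\<phi> \<^bold>\<or> \<psi>) \<longleftrightarrow> sat F V w \<phi> \<or> sat F V w \<psi>"
| "sat F V w (\<phi> \<^bold>\<rightarrow> \<psi>) \<longleftrightarrow> (\<forall>v. (w, v) \<in> ile F \<longrightarrow> sat F V v \<phi> \<longrightarrow> sat F V v \<psi>)"
| "sat F V w (\<^bold>\<diamond> \<phi>) \<longleftrightarrow> (\<forall>u. (w, u) \<in> ile F \<longrightarrow> (\<exists>v. (u, v) \<in> mle F \<and> sat F V v \<phi>))"
| "sat F V w (\<^bold>\<box> \<phi>) \<longleftrightarrow> (\<forall>u v. (w, u) \<in> ile F \<longrightarrow> (u, v) \<in> mle F \<longrightarrow> sat F V v \<phi>)"

text \<open>HOL cannot quantify over types inside a formula, so semantic consequence carries the type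
  \<open>'w\<close> that the worlds are drawn from; the set of worlds is an arbitrary subset of it.\<close>

definition sem_conseq :: "'w itself \<Rightarrow> logic_name \<Rightarrow> 'p fm set \<Rightarrow> 'p fm \<Rightarrow> bool" where
  "sem_conseq (_ :: 'w itself) \<Lambda> \<Gamma> \<phi> \<longleftrightarrow>
     (\<forall>(F :: 'w frame) V w. frame_for \<Lambda> F \<longrightarrow> valuation F V \<longrightarrow> w \<in> worlds F - fallible F \<longrightarrow>
        (\<forall>\<psi>\<in>\<Gamma>. sat F V w \<psi>) \<longrightarrow> sat F V w \<phi>)"

text \<open>A type of worlds that is large enough to carry counter-models: the formulas are countable,
  so this asks for at least continuum many elements.\<close>

definition large_universe :: "'p itself \<Rightarrow> 'w itself \<Rightarrow> bool" where
  "large_universe (_ :: 'p itself) (_ :: 'w itself) \<longleftrightarrow> (\<exists>f :: 'p fm set \<Rightarrow> 'w. inj f)"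

end

theory Submission
  imports Defs
begin

text \<open>For completeness, take all prime theories as worlds, ordered intuitionistically by inclusion,
  with \<open>A\<close> modally below \<open>B\<close> iff \<open>{\<phi>. \<^bold>\<box> \<phi> \<in> A} \<subseteq> B \<subseteq> {\<phi>. \<^bold>\<diamond> \<phi> \<in> A}\<close>. Every world that the truth
  lemma or a confluence condition asks for must contain one set of formulas and avoid another; a
  prime theory of this kind exists as soon as the first set derives no member of the second, provided
  that the second is directed under implication. DP and N make \<open>{\<phi>. \<^bold>\<diamond> \<phi> \<notin> A}\<close> directed, which gives
  forth--up confluence and the diamond case; FS2 gives back--up confluence, CD gives
  forth--down confluence, either one gives the box case, and GD gives upward linearity.\<close>

section \<open>Soundness\<close>

text \<open>This set is one of the sets whose intersection defines a logic as soon as it contains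
  the axioms and is closed under substitution and the rules; soundness is then minimality of the
  logic.\<close>

definition validities :: "('w frame \<Rightarrow> bool) \<Rightarrow> 'p fm set" where
  "validities C = {\<phi>. \<forall>F V w. C F \<longrightarrow> valuation F V \<longrightarrow> w \<in> worlds F \<longrightarrow> sat F V w \<phi>}"

lemma validitiesI:
  "(\<And>F V w. C F \<Longrightarrow> valuation F V \<Longrightarrow> w \<in> worlds F \<Longrightarrow> sat F V w \<phi>) \<Longrightarrow> \<phi> \<in> validities C"
  by (simp add: validities_def)

lemma validitiesD:
  "\<phi> \<in> validities C \<Longrightarrow> C F \<Longrightarrow> valuation F V \<Longrightarrow> w \<in> worlds F \<Longrightarrow> sat F V w \<phi>"
  by (simp add: validities_def)

section \<open>Satisfaction in a single frame\<close>

context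
  fixes F :: "'w frame"
  assumes frame: "bi_intuitionistic_frame F"
begin

lemma ile_in_worlds: "(w, v) \<in> ile F \<Longrightarrow> w \<in> worlds F \<and> v \<in> worlds F"
  using frame unfolding bi_intuitionistic_frame_def preorder_on_def refl_on_def by blast

lemma mle_in_worlds: "(w, v) \<in> mle F \<Longrightarrow> w \<in> worlds F \<and> v \<in> worlds F"
  using frame unfolding bi_intuitionistic_frame_def preorder_on_def refl_on_def by blast

lemma ile_refl: "w \<in> worlds F \<Longrightarrow> (w, w) \<in> ile F"
  using frame unfolding bi_intuitionistic_frame_def preorder_on_def refl_on_def by blast

lemma mle_refl: "w \<in> worlds F \<Longrightarrow> (w, w) \<in> mle F"
  using frame unfolding bi_intuitionistic_frame_def preorder_on_def refl_on_def by blast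

lemma ile_trans: "(u, v) \<in> ile F \<Longrightarrow> (v, w) \<in> ile F \<Longrightarrow> (u, w) \<in> ile F"
  using frame unfolding bi_intuitionistic_frame_def preorder_on_def by (meson transD)

lemma mle_trans: "(u, v) \<in> mle F \<Longrightarrow> (v, w) \<in> mle F \<Longrightarrow> (u, w) \<in> mle F"
  using frame unfolding bi_intuitionistic_frame_def preorder_on_def by (meson transD)

text \<open>The clauses for implication, diamond and box open with a quantifier over intuitionistic
  successors, so transitivity of \<open>ile F\<close> carries them upward.\<close>

lemma sat_persistent:
  assumes "valuation F V"
  shows "sat F V w \<phi> \<Longrightarrow> (w, v) \<in> ile F \<Longrightarrow> sat F V v \<phi>"
proof (induction \<phi> arbitrary: w v)
  case (Var p)
  then show ?case using assms by (auto simp: valuation_def)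
next
  case Bot
  then show ?case using frame unfolding bi_intuitionistic_frame_def sat.simps by blast
next
  case (Imp \<phi> \<psi>)
  then show ?case using ile_trans[of w v] by simp
next
  case (Dia \<phi>)
  then show ?case using ile_trans[of w v] by simp
next
  case (Box \<phi>)
  then show ?case using ile_trans[of w v] by simp blast
qed auto

text \<open>A substitution acts like the valuation sending \<open>p\<close> to the truth set of
  \<open>\<sigma> p\<close>. The set is cut down to \<open>worlds F\<close> because implications and
  modal formulas hold vacuously elsewhere.\<close>

lemma sat_subst:
  assumes "valuation F V" "w \<in> worlds F"
  shows "sat F V w (subst \<sigma> \<phi>) \<longleftrightarrow> sat F (\<lambda>p. {w \<in> worlds F. sat F V w (\<sigma> p)}) w \<phi>"
  using assms(2)
proof (induction \<phi> arbitrary: w)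
  case (Imp \<phi> \<psi>)
  then show ?case using ile_in_worlds by (simp cong: imp_cong)
next
  case (Dia \<phi>)
  then show ?case using ile_in_worlds mle_in_worlds by (simp; blast)
next
  case (Box \<phi>)
  then show ?case using ile_in_worlds mle_in_worlds by (simp; blast)
qed auto

text \<open>Forth--up confluence moves a modal witness for \<open>w\<close> to every intuitionistic
  successor of \<open>w\<close>, and persistence keeps the formula true at the moved
  witness.\<close>

lemma sat_Dia_iff:
  assumes "valuation F V" "forth_up_confluent F" "w \<in> worlds F"
  shows "sat F V w (\<^bold>\<diamond> \<phi>) \<longleftrightarrow> (\<exists>v. (w, v) \<in> mle F \<and> sat F V v \<phi>)"
  using assms(2,3) ile_refl sat_persistent[OF assms(1)]
  unfolding forth_up_confluent_def sat.simps by meson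

text \<open>Forth--down confluence turns a path \<open>w \<preceq> u \<sqsubseteq> v\<close> into
  some \<open>w \<sqsubseteq> w' \<preceq> v\<close>; persistence then carries truth from
  \<open>w'\<close> to \<open>v\<close>.\<close>

lemma sat_Box_iff:
  assumes "valuation F V" "forth_down_confluent F" "w \<in> worlds F"
  shows "sat F V w (\<^bold>\<box> \<phi>) \<longleftrightarrow> (\<forall>v. (w, v) \<in> mle F \<longrightarrow> sat F V v \<phi>)"
  using assms(2,3) ile_refl sat_persistent[OF assms(1)]
  unfolding forth_down_confluent_def sat.simps by meson

lemma sat_Conj: "infallible F \<Longrightarrow> sat F V w (Conj \<psi>s) \<longleftrightarrow> (\<forall>\<psi>\<in>set \<psi>s. sat F V w \<psi>)"
  by (induction \<psi>s) (auto simp: Conj_def)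

end

text \<open>The record command also generates a fact \<open>extend_def\<close>, which shadows the one on logics.\<close>

hide_fact (open) frame.extend_def

lemma extend_least:
  "is_logic L' \<Longrightarrow> mp_closed L' \<Longrightarrow> nec_closed L' \<Longrightarrow> L \<subseteq> L' \<Longrightarrow> A \<subseteq> L' \<Longrightarrow> L \<^bold>+ A \<subseteq> L'"
  unfolding extend_def by (rule Inter_lower) simp

section \<open>Rules and axioms valid on a class of infallible forth--up confluent frames\<close>

context
  fixes C :: "'w frame \<Rightarrow> bool"
  assumes bi: "\<And>F. C F \<Longrightarrow> bi_intuitionistic_frame F"
    and infal: "\<And>F. C F \<Longrightarrow> infallible F"
    and forth_up: "\<And>F. C F \<Longrightarrow> forth_up_confluent F"
begin

lemma is_logic_validities: "is_logic (validities C :: 'p fm set)"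
  unfolding is_logic_def
proof (intro allI impI validitiesI)
  fix \<sigma> :: "'p \<Rightarrow> 'p fm" and \<phi> :: "'p fm" and F and V :: "'p \<Rightarrow> 'w set" and w
  assume *: "\<phi> \<in> validities C" "C F" "valuation F V" "w \<in> worlds F"
  \<comment> \<open>Persistence makes the truth sets upward closed, and infallibility makes the
    condition on fallible worlds trivial.\<close>
  have "valuation F (\<lambda>p. {w \<in> worlds F. sat F V w (\<sigma> p)})"
    using infal[OF *(2)] sat_persistent[OF bi[OF *(2)] *(3)] ile_in_worlds[OF bi[OF *(2)]]
    unfolding valuation_def infallible_def by blast
  from sat_subst[OF bi[OF *(2)] *(3,4)] validitiesD[OF *(1,2) this *(4)]
  show "sat F V w (subst \<sigma> \<phi>)"
    by (rule iffD2)
qed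

lemma mp_closed_validities: "mp_closed (validities C :: 'p fm set)"
  unfolding mp_closed_def
proof (intro allI impI validitiesI)
  fix \<phi> \<psi> :: "'p fm" and F and V :: "'p \<Rightarrow> 'w set" and w
  assume *: "(\<phi> \<^bold>\<rightarrow> \<psi>) \<in> validities C" "\<phi> \<in> validities C" "C F" "valuation F V" "w \<in> worlds F"
  then show "sat F V w \<psi>"
    using validitiesD[OF *(1,3-5)] validitiesD[OF *(2-5)] ile_refl[OF bi] by auto
qed

lemma nec_closed_validities: "nec_closed (validities C :: 'p fm set)"
  unfolding nec_closed_def
proof (intro allI impI validitiesI)
  fix \<phi> :: "'p fm" and F and V :: "'p \<Rightarrow> 'w set" and w
  assume *: "\<phi> \<in> validities C" "C F" "valuation F V" "w \<in> worlds F"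
  then show "sat F V w (\<^bold>\<box> \<phi>)"
    using validitiesD[OF *(1-3)] mle_in_worlds[OF bi] by auto
qed

lemma IPC_valid: "IPC \<subseteq> validities C"
proof
  fix \<phi> :: "'p fm"
  assume "\<phi> \<in> IPC"
  then show "\<phi> \<in> validities C"
  proof induction
    case (ax_K \<phi> \<psi>)
    show ?case
      using sat_persistent[OF bi] by (auto intro!: validitiesI)
  next
    case (ax_S \<phi> \<psi> \<chi>)
    show ?case
      by (rule validitiesI) (simp, meson bi ile_in_worlds ile_refl ile_trans)
  next
    case (conj_intro \<phi> \<psi>)
    show ?case
      using sat_persistent[OF bi] by (auto intro!: validitiesI)
  next
    case (disj_elim \<phi> \<chi> \<psi>)
    show ?case
      by (rule validitiesI) (simp, meson bi ile_in_worlds ile_refl ile_trans)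
  next
    case (ex_falso \<phi>)
    show ?case
      using infal by (auto intro!: validitiesI simp: infallible_def)
  next
    case (mp \<phi> \<psi>)
    then show ?case using mp_closed_validities unfolding mp_closed_def by blast
  qed (auto intro!: validitiesI)
qed

text \<open>The assumption \<open>updown\<close> serves \<open>B4\<close>, where a path
  \<open>v \<preceq> u \<sqsubseteq> z \<preceq> x \<sqsubseteq> y\<close> must be shortened to the
  form that the clause for box speaks about.\<close>

lemma CS4_axioms_valid:
  assumes updown: "\<And>F. C F \<Longrightarrow> back_up_confluent F \<or> forth_down_confluent F"
  shows "(CS4_axioms :: 'p fm set) \<subseteq> validities C"
proof -
  have KB: "\<^bold>\<box> (\<phi> \<^bold>\<rightarrow> \<psi>) \<^bold>\<rightarrow> \<^bold>\<box> \<phi> \<^bold>\<rightarrow> \<^bold>\<box> \<psi> \<in> validities C" for \<phi> \<psi> :: "'p fm"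
    by (rule validitiesI) (simp, meson bi mle_in_worlds ile_refl ile_trans)
  have KD: "\<^bold>\<box> (\<phi> \<^bold>\<rightarrow> \<psi>) \<^bold>\<rightarrow> \<^bold>\<diamond> \<phi> \<^bold>\<rightarrow> \<^bold>\<diamond> \<psi> \<in> validities C" for \<phi> \<psi> :: "'p fm"
    by (rule validitiesI) (simp, meson bi mle_in_worlds ile_refl ile_trans)
  have TB: "\<^bold>\<box> \<phi> \<^bold>\<rightarrow> \<phi> \<in> validities C" for \<phi> :: "'p fm"
    by (rule validitiesI) (simp, meson bi ile_in_worlds ile_refl mle_refl)
  have TD: "\<phi> \<^bold>\<rightarrow> \<^bold>\<diamond> \<phi> \<in> validities C" for \<phi> :: "'p fm"
    by (rule validitiesI) (simp, meson bi ile_in_worlds mle_refl sat_persistent)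
  have D4: "\<^bold>\<diamond> (\<^bold>\<diamond> \<phi>) \<^bold>\<rightarrow> \<^bold>\<diamond> \<phi> \<in> validities C" for \<phi> :: "'p fm"
    by (rule validitiesI) (simp, meson bi mle_in_worlds ile_refl mle_trans)
  have B4: "\<^bold>\<box> \<phi> \<^bold>\<rightarrow> \<^bold>\<box> (\<^bold>\<box> \<phi>) \<in> validities C" for \<phi> :: "'p fm"
  proof (rule validitiesI)
    fix F and V :: "'p \<Rightarrow> 'w set" and w
    assume F: "C F" "valuation F V" "w \<in> worlds F"
    note frame = bi[OF F(1)]
    have "sat F V y \<phi>"
      if wv: "sat F V v (\<^bold>\<box> \<phi>)" "(v, u) \<in> ile F" "(u, z) \<in> mle F" "(z, x) \<in> ile F" "(x, y) \<in> mle F"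
      for u v x y z
      using updown[OF F(1)]
    proof
      \<comment> \<open>The steps from \<open>u\<close> to \<open>x\<close> are swapped, after which
        like steps are adjacent and merge by transitivity:
        \<open>v \<preceq> u' \<sqsubseteq> y\<close>.\<close>
      assume "back_up_confluent F"
      then obtain u' where "(u, u') \<in> ile F" "(u', x) \<in> mle F"
        using wv unfolding back_up_confluent_def by blast
      then show ?thesis
        using wv(1) ile_trans[OF frame wv(2)] mle_trans[OF frame _ wv(5)] unfolding sat.simps by blast
    next
      \<comment> \<open>The steps from \<open>z\<close> to \<open>y\<close> are swapped; box then
        yields the formula at \<open>y'\<close>, which lies below \<open>y\<close> in the
        intuitionistic order.\<close>
      assume "forth_down_confluent F"
      then obtain y' where "(z, y') \<in> mle F" "(y', y) \<in> ile F"
        using wv unfolding forth_down_confluent_def by blast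
      then show ?thesis
        using wv(1,2) mle_trans[OF frame wv(3)] sat_persistent[OF frame F(2)] unfolding sat.simps by blast
    qed
    then show "sat F V w (\<^bold>\<box> \<phi> \<^bold>\<rightarrow> \<^bold>\<box> (\<^bold>\<box> \<phi>))"
      by auto
  qed
  show ?thesis
    using KB KD TB TD D4 B4 by (auto simp: CS4_axioms_def)
qed

lemma CS4_valid:
  assumes "\<And>F. C F \<Longrightarrow> back_up_confluent F \<or> forth_down_confluent F"
  shows "(CS4 :: 'p fm set) \<subseteq> validities C"
  unfolding CS4_def
  by (intro extend_least is_logic_validities mp_closed_validities nec_closed_validities IPC_valid
      CS4_axioms_valid assms)

text \<open>Under forth--up confluence the diamond is a plain existential over modal successors, and
  this distributes over disjunction.\<close>

lemma DP_valid: "(DP :: 'p fm set) \<subseteq> validities C"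
proof -
  have "sat F V w (\<^bold>\<diamond> (Var p \<^bold>\<or> Var q) \<^bold>\<rightarrow> \<^bold>\<diamond> (Var p) \<^bold>\<or> \<^bold>\<diamond> (Var q))"
    if "C F" "valuation F V" "w \<in> worlds F" for F V w and p q :: 'p
    using that sat_Dia_iff[OF bi[OF that(1)] that(2) forth_up[OF that(1)]]
      ile_in_worlds[OF bi[OF that(1)]]
    by (auto simp del: sat.simps(6))
  then show ?thesis
    unfolding DP_def by (blast intro: validitiesI)
qed

lemma N_valid: "(N :: 'p fm set) \<subseteq> validities C"
proof -
  have "sat F V w (\<^bold>\<not> (\<^bold>\<diamond> \<^bold>\<bottom>))"
    if "C F" "valuation F V" "w \<in> worlds F" for F V w
    using ile_refl[OF bi[OF that(1)]] ile_in_worlds[OF bi[OF that(1)]] infal[OF that(1)]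
    by (auto simp: infallible_def)
  then show ?thesis
    unfolding N_def by (blast intro: validitiesI)
qed

lemma FS2_valid:
  assumes "\<And>F. C F \<Longrightarrow> back_up_confluent F"
  shows "(FS2 :: 'p fm set) \<subseteq> validities C"
proof -
  have "sat F V w ((\<^bold>\<diamond> \<phi> \<^bold>\<rightarrow> \<^bold>\<box> \<psi>) \<^bold>\<rightarrow> \<^bold>\<box> (\<phi> \<^bold>\<rightarrow> \<psi>))"
    if F: "C F" "valuation F V" "w \<in> worlds F" for F w and V :: "'p \<Rightarrow> 'w set" and \<phi> \<psi>
  proof -
    note frame = bi[OF F(1)]
    have key: "sat F V x \<psi>"
      if x: "sat F V v (\<^bold>\<diamond> \<phi> \<^bold>\<rightarrow> \<^bold>\<box> \<psi>)" "(v, u) \<in> ile F" "(u, z) \<in> mle F" "(z, x) \<in> ile F"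
        "sat F V x \<phi>" for u v x z
    proof -
      \<comment> \<open>Back--up confluence provides a world above \<open>u\<close> that sees
        \<open>x\<close> directly. It satisfies the antecedent \<open>\<diamond> \<phi>\<close>
        because of \<open>x\<close>, and the resulting \<open>\<box> \<psi>\<close> applies to
        \<open>x\<close> again.\<close>
      obtain u' where u': "(u, u') \<in> ile F" "(u', x) \<in> mle F"
        using x assms[OF F(1)] unfolding back_up_confluent_def by blast
      then have "sat F V u' (\<^bold>\<diamond> \<phi>)"
        using x sat_Dia_iff[OF frame F(2) forth_up[OF F(1)]] mle_in_worlds[OF frame] by blast
      moreover have "(v, u') \<in> ile F"
        using x u' ile_trans[OF frame] by blast
      ultimately have "sat F V u' (\<^bold>\<box> \<psi>)"
        using sat.simps(5)[THEN iffD1, OF x(1)] by blast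
      then show ?thesis
        using u' ile_refl[OF frame] mle_in_worlds[OF frame] by auto
    qed
    show ?thesis
    proof (rule sat.simps(5)[THEN iffD2], intro allI impI)
      fix v
      assume v: "sat F V v (\<^bold>\<diamond> \<phi> \<^bold>\<rightarrow> \<^bold>\<box> \<psi>)"
      show "sat F V v (\<^bold>\<box> (\<phi> \<^bold>\<rightarrow> \<psi>))"
        by (rule sat.simps(7)[THEN iffD2], intro allI impI, rule sat.simps(5)[THEN iffD2])
          (blast intro: key[OF v])
    qed
  qed
  then show ?thesis
    unfolding FS2_def by (blast intro: validitiesI)
qed

text \<open>With both confluence conditions box and diamond are dual quantifiers over the same modal
  successors, so the axiom is a classical case split: all successors satisfy \<open>p\<close>, or
  one of them satisfies \<open>q\<close>.\<close>

lemma CD_valid: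
  assumes "\<And>F. C F \<Longrightarrow> forth_down_confluent F"
  shows "(CD :: 'p fm set) \<subseteq> validities C"
proof -
  have "sat F V w (\<^bold>\<box> (Var p \<^bold>\<or> Var q) \<^bold>\<rightarrow> \<^bold>\<box> (Var p) \<^bold>\<or> \<^bold>\<diamond> (Var q))"
    if F: "C F" "valuation F V" "w \<in> worlds F" for F V w and p q :: 'p
    using ile_in_worlds[OF bi[OF F(1)]]
      sat_Dia_iff[OF bi[OF F(1)] F(2) forth_up[OF F(1)]]
      sat_Box_iff[OF bi[OF F(1)] F(2) assms[OF F(1)]]
    by (auto simp del: sat.simps(6,7))
  then show ?thesis
    unfolding CD_def by (blast intro: validitiesI)
qed

text \<open>Worlds refuting the two implications would be comparable, and persistence from the lower
  to the upper one contradicts a refutation.\<close>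

lemma GD_valid:
  assumes "\<And>F. C F \<Longrightarrow> upward_linear F"
  shows "(GD :: 'p fm set) \<subseteq> validities C"
proof -
  have "sat F V w ((\<phi> \<^bold>\<rightarrow> \<psi>) \<^bold>\<or> (\<psi> \<^bold>\<rightarrow> \<phi>))"
    if F: "C F" "valuation F V" "w \<in> worlds F" for F w and V :: "'p \<Rightarrow> 'w set" and \<phi> \<psi>
    using assms[OF F(1)] sat_persistent[OF bi[OF F(1)] F(2)]
    unfolding upward_linear_def sat.simps by meson
  then show ?thesis
    unfolding GD_def by (blast intro: validitiesI)
qed

end

section \<open>Soundness of the four logics\<close>

lemma frame_for_bi: "frame_for \<Lambda> F \<Longrightarrow> bi_intuitionistic_frame F"
  and frame_for_infallible: "frame_for \<Lambda> F \<Longrightarrow> infallible F"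
  and frame_for_forth_up: "frame_for \<Lambda> F \<Longrightarrow> forth_up_confluent F"
  and frame_for_transfer: "frame_for \<Lambda> F \<Longrightarrow> back_up_confluent F \<or> forth_down_confluent F"
  by (cases \<Lambda>; simp add: IS4_frame_def S4I_frame_def GS4_frame_def GS4c_frame_def)+

text \<open>Each logic lies in the validities by minimality. Since the logics are built on one
  another, the inclusion of a smaller logic is proved for the frame classes of all logics extending
  it.\<close>

lemma logic_of_valid: "logic_of \<Lambda> \<subseteq> validities (frame_for \<Lambda>)"
proof -
  let ?C = "frame_for \<Lambda>"
  note closed = is_logic_validities[of ?C, OF frame_for_bi[of \<Lambda>] frame_for_infallible[of \<Lambda>]
        frame_for_forth_up[of \<Lambda>]]
    mp_closed_validities[of ?C, OF frame_for_bi[of \<Lambda>] frame_for_infallible[of \<Lambda>]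
        frame_for_forth_up[of \<Lambda>]]
    nec_closed_validities[of ?C, OF frame_for_bi[of \<Lambda>] frame_for_infallible[of \<Lambda>]
        frame_for_forth_up[of \<Lambda>]]
  have base: "CS4 \<subseteq> validities ?C"
    by (intro CS4_valid; auto intro: frame_for_bi frame_for_infallible frame_for_forth_up
        dest: frame_for_transfer)
  have DPN: "DP \<subseteq> validities ?C" "N \<subseteq> validities ?C"
    by (intro DP_valid N_valid; auto intro: frame_for_bi frame_for_infallible frame_for_forth_up)+
  have FS2: "FS2 \<subseteq> validities ?C" if "\<Lambda> \<noteq> Name_S4I"
    using that by (intro FS2_valid; cases \<Lambda>)
      (auto simp: IS4_frame_def GS4_frame_def GS4c_frame_def)
  have CD: "CD \<subseteq> validities ?C" if "\<Lambda> = Name_S4I \<or> \<Lambda> = Name_GS4c"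
    using that by (intro CD_valid; cases \<Lambda>)
      (auto simp: IS4_frame_def S4I_frame_def GS4_frame_def GS4c_frame_def)
  have GD: "GD \<subseteq> validities ?C" if "\<Lambda> = Name_GS4 \<or> \<Lambda> = Name_GS4c"
    using that by (intro GD_valid; cases \<Lambda>)
      (auto simp: IS4_frame_def GS4_frame_def GS4c_frame_def)
  have IS4: "IS4 \<subseteq> validities ?C" if "\<Lambda> \<noteq> Name_S4I"
    unfolding IS4_def by (intro extend_least closed base Un_least DPN FS2 that)
  have S4I: "S4I \<subseteq> validities ?C" if "\<Lambda> = Name_S4I"
    unfolding S4I_def by (intro extend_least closed base Un_least DPN CD disjI1 that)
  have GS4: "GS4 \<subseteq> validities ?C" if "\<Lambda> = Name_GS4 \<or> \<Lambda> = Name_GS4c"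
    unfolding GS4_def using that by (intro extend_least closed IS4 GD) auto
  have GS4c: "GS4c \<subseteq> validities ?C" if "\<Lambda> = Name_GS4c"
    unfolding GS4c_def using that by (intro extend_least closed GS4 CD) auto
  show ?thesis
    using IS4 S4I GS4 GS4c by (cases \<Lambda>) simp_all
qed

lemma soundness:
  fixes \<Lambda> :: logic_name
  assumes "syn_conseq \<Lambda> \<Gamma> \<phi>"
  shows "sem_conseq TYPE('w) \<Lambda> \<Gamma> \<phi>"
  unfolding sem_conseq_def
proof (intro allI impI)
  fix F :: "'w frame" and V w
  assume F: "frame_for \<Lambda> F" "valuation F V" "w \<in> worlds F - fallible F"
    and \<Gamma>: "\<forall>\<psi>\<in>\<Gamma>. sat F V w \<psi>"
  obtain \<psi>s where \<psi>s: "set \<psi>s \<subseteq> \<Gamma>" "Conj \<psi>s \<^bold>\<rightarrow> \<phi> \<in> logic_of \<Lambda>"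
    using assms unfolding syn_conseq_def by blast
  have "sat F V w (Conj \<psi>s)"
    using sat_Conj[OF frame_for_bi[OF F(1)] frame_for_infallible[OF F(1)]] \<Gamma> \<psi>s(1) by blast
  moreover have "sat F V w (Conj \<psi>s \<^bold>\<rightarrow> \<phi>)"
    using logic_of_valid \<psi>s(2) F by (blast intro: validitiesD)
  ultimately show "sat F V w \<phi>"
    using F(3) ile_refl[OF frame_for_bi[OF F(1)]] by auto
qed


section \<open>Completeness\<close>

definition box_inv :: "'p fm set \<Rightarrow> 'p fm set" where
  "box_inv T = {\<phi>. \<^bold>\<box> \<phi> \<in> T}"

definition dia_inv :: "'p fm set \<Rightarrow> 'p fm set" where
  "dia_inv T = {\<phi>. \<^bold>\<diamond> \<phi> \<in> T}"

text \<open>The first inclusion serves the box clause of the truth lemma, the second the diamond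
  clause.\<close>

definition acc :: "'p fm set \<Rightarrow> 'p fm set \<Rightarrow> bool" where
  "acc T U \<longleftrightarrow> box_inv T \<subseteq> U \<and> U \<subseteq> dia_inv T"

text \<open>This is the part common to all four logics. FS2, CD and GD stay assumptions of
  individual lemmas, so that one canonical construction covers every case.\<close>

locale modal_logic =
  fixes L :: "('p :: infinite) fm set"
  assumes is_logic: "is_logic L"
    and mp_closed: "mp_closed L"
    and nec_closed: "nec_closed L"
    and IPC_subset: "IPC \<subseteq> L"
    and CS4_axioms_subset: "CS4_axioms \<subseteq> L"
    and DP_subset: "DP \<subseteq> L"
    and N_subset: "N \<subseteq> L"
begin

subsection \<open>Derivations from hypotheses\<close>

text \<open>Necessitation is not a rule here, which gives the deduction theorem; theorems of
  \<open>L\<close>, already closed under it, enter as axioms.\<close>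

inductive derives :: "'p fm set \<Rightarrow> 'p fm \<Rightarrow> bool"  (infix "\<turnstile>" 50) for A where
  derives_logic: "\<phi> \<in> L \<Longrightarrow> A \<turnstile> \<phi>"
| derives_hyp: "\<phi> \<in> A \<Longrightarrow> A \<turnstile> \<phi>"
| derives_mp: "A \<turnstile> \<phi> \<^bold>\<rightarrow> \<psi> \<Longrightarrow> A \<turnstile> \<phi> \<Longrightarrow> A \<turnstile> \<psi>"

lemma derives_IPC: "\<phi> \<in> IPC \<Longrightarrow> A \<turnstile> \<phi>"
  using IPC_subset by (blast intro: derives_logic)

lemma derives_cut: "A \<turnstile> \<phi> \<Longrightarrow> (\<And>\<psi>. \<psi> \<in> A \<Longrightarrow> B \<turnstile> \<psi>) \<Longrightarrow> B \<turnstile> \<phi>"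
  by (induction rule: derives.induct) (auto intro: derives.intros)

lemma derives_mono: "A \<turnstile> \<phi> \<Longrightarrow> A \<subseteq> B \<Longrightarrow> B \<turnstile> \<phi>"
  by (rule derives_cut) (auto intro: derives_hyp)

lemma derives_empty: "{} \<turnstile> \<phi> \<Longrightarrow> \<phi> \<in> L"
  by (induction rule: derives.induct) (use mp_closed in \<open>auto simp: mp_closed_def\<close>)

lemma derives_weaken: "A \<turnstile> \<phi> \<Longrightarrow> A \<turnstile> \<psi> \<^bold>\<rightarrow> \<phi>"
  using derives_IPC[OF ax_K] derives_mp by blast

lemma derives_refl: "A \<turnstile> \<psi> \<^bold>\<rightarrow> \<psi>"
  using derives_IPC[OF ax_S[of \<psi> "\<psi> \<^bold>\<rightarrow> \<psi>" \<psi>]] derives_IPC[OF ax_K] derives_mp by blast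

lemma deduction: "insert \<psi> A \<turnstile> \<phi> \<Longrightarrow> A \<turnstile> \<psi> \<^bold>\<rightarrow> \<phi>"
proof (induction rule: derives.induct)
  case (derives_logic \<phi>)
  then show ?case by (blast intro: derives_weaken derives.intros)
next
  case (derives_hyp \<phi>)
  then show ?case by (auto intro: derives_refl derives_weaken derives.intros)
next
  case (derives_mp \<phi> \<chi>)
  then show ?case using derives_IPC[OF ax_S] derives.derives_mp by blast
qed

lemma derives_conjI: "A \<turnstile> \<phi> \<Longrightarrow> A \<turnstile> \<psi> \<Longrightarrow> A \<turnstile> \<phi> \<^bold>\<and> \<psi>"
  using derives_IPC[OF conj_intro] derives_mp by blast

lemma derives_disjE:
  "A \<turnstile> \<phi> \<^bold>\<or> \<psi> \<Longrightarrow> insert \<phi> A \<turnstile> \<chi> \<Longrightarrow> insert \<psi> A \<turnstile> \<chi> \<Longrightarrow> A \<turnstile> \<chi>"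
  by (rule derives_mp[OF derives_mp[OF derives_mp[OF derives_IPC[OF disj_elim[of \<phi> \<chi> \<psi>]]]]])
    (simp_all add: deduction)

lemma derives_finite: "A \<turnstile> \<phi> \<Longrightarrow> \<exists>\<psi>s. set \<psi>s \<subseteq> A \<and> set \<psi>s \<turnstile> \<phi>"
proof (induction rule: derives.induct)
  case (derives_logic \<phi>)
  then have "set [] \<subseteq> A \<and> set [] \<turnstile> \<phi>" by (auto intro: derives.intros)
  then show ?case by blast
next
  case (derives_hyp \<phi>)
  then have "set [\<phi>] \<subseteq> A \<and> set [\<phi>] \<turnstile> \<phi>" by (auto intro: derives.intros)
  then show ?case by blast
next
  case (derives_mp \<phi> \<psi>)
  then obtain \<psi>s \<chi>s where *: "set \<psi>s \<subseteq> A" "set \<psi>s \<turnstile> \<phi> \<^bold>\<rightarrow> \<psi>" "set \<chi>s \<subseteq> A" "set \<chi>s \<turnstile> \<phi>"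
    by blast
  have "set (\<psi>s @ \<chi>s) \<turnstile> \<psi>"
    by (rule derives.derives_mp; rule derives_mono, rule *) auto
  moreover have "set (\<psi>s @ \<chi>s) \<subseteq> A"
    using * by simp
  ultimately show ?case by blast
qed

lemma Conj_derives: "\<psi> \<in> set \<psi>s \<Longrightarrow> {Conj \<psi>s} \<turnstile> \<psi>"
proof (induction \<psi>s)
  case (Cons \<chi> \<psi>s)
  have "{Conj (\<chi> # \<psi>s)} \<turnstile> \<chi> \<^bold>\<and> Conj \<psi>s"
    by (simp add: Conj_def derives_hyp)
  from derives_mp[OF derives_IPC[OF conj_elim1] this] derives_mp[OF derives_IPC[OF conj_elim2] this]
  have "{Conj (\<chi> # \<psi>s)} \<turnstile> \<chi>" "{Conj (\<chi> # \<psi>s)} \<turnstile> Conj \<psi>s" .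
  then show ?case
    using Cons derives_cut[of "{Conj \<psi>s}" \<psi> "{Conj (\<chi> # \<psi>s)}"] by auto
qed simp

text \<open>This brings derivability into the shape of \<open>syn_conseq\<close>: the finitely many
  hypotheses used are conjoined and discharged by the deduction theorem.\<close>

lemma derives_Conj:
  assumes "\<Gamma> \<turnstile> \<phi>"
  shows "\<exists>\<psi>s. set \<psi>s \<subseteq> \<Gamma> \<and> (Conj \<psi>s \<^bold>\<rightarrow> \<phi>) \<in> L"
proof -
  obtain \<psi>s where "set \<psi>s \<subseteq> \<Gamma>" "set \<psi>s \<turnstile> \<phi>"
    using derives_finite[OF assms] by blast
  moreover from this have "{Conj \<psi>s} \<turnstile> \<phi>"
    using Conj_derives derives_cut by blast
  ultimately show ?thesis
    using deduction derives_empty by blast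
qed

subsection \<open>Instances of the axioms\<close>

lemma substituted: "\<phi> \<in> L \<Longrightarrow> subst \<sigma> \<phi> \<in> L"
  using is_logic by (simp add: is_logic_def)

text \<open>The axioms are stated for distinct variables, so an arbitrary instance arises by
  substituting for two of them; the infinite type supplies the pair.\<close>

lemma two_variables:
  fixes \<phi> \<psi> :: "'p fm"
  obtains p q :: 'p and \<sigma> where "p \<noteq> q" "\<sigma> p = \<phi>" "\<sigma> q = \<psi>"
proof -
  fix p :: 'p
  obtain q where "q \<noteq> p"
    using ex_new_if_finite[OF infinite_UNIV, of "{p}"] by auto
  then show thesis
    using that[of p q "(\<lambda>_. \<psi>)(p := \<phi>)"] by simp
qed

lemma box_K: "(\<^bold>\<box> (\<phi> \<^bold>\<rightarrow> \<psi>) \<^bold>\<rightarrow> \<^bold>\<box> \<phi> \<^bold>\<rightarrow> \<^bold>\<box> \<psi>) \<in> L"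
proof -
  obtain p q :: 'p and \<sigma> where v: "p \<noteq> q" "\<sigma> p = \<phi>" "\<sigma> q = \<psi>"
    by (rule two_variables)
  have "(\<^bold>\<box> (Var p \<^bold>\<rightarrow> Var q) \<^bold>\<rightarrow> \<^bold>\<box> (Var p) \<^bold>\<rightarrow> \<^bold>\<box> (Var q)) \<in> L"
    by (rule subsetD[OF CS4_axioms_subset]) (simp add: CS4_axioms_def v(1))
  from substituted[OF this, of \<sigma>] show ?thesis by (simp add: v)
qed

lemma dia_K: "(\<^bold>\<box> (\<phi> \<^bold>\<rightarrow> \<psi>) \<^bold>\<rightarrow> \<^bold>\<diamond> \<phi> \<^bold>\<rightarrow> \<^bold>\<diamond> \<psi>) \<in> L"
proof -
  obtain p q :: 'p and \<sigma> where v: "p \<noteq> q" "\<sigma> p = \<phi>" "\<sigma> q = \<psi>"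
    by (rule two_variables)
  have "(\<^bold>\<box> (Var p \<^bold>\<rightarrow> Var q) \<^bold>\<rightarrow> \<^bold>\<diamond> (Var p) \<^bold>\<rightarrow> \<^bold>\<diamond> (Var q)) \<in> L"
    by (rule subsetD[OF CS4_axioms_subset]) (simp add: CS4_axioms_def v(1))
  from substituted[OF this, of \<sigma>] show ?thesis by (simp add: v)
qed

lemma box_T: "(\<^bold>\<box> \<phi> \<^bold>\<rightarrow> \<phi>) \<in> L"
  and dia_T: "(\<phi> \<^bold>\<rightarrow> \<^bold>\<diamond> \<phi>) \<in> L"
  and dia_4: "(\<^bold>\<diamond> (\<^bold>\<diamond> \<phi>) \<^bold>\<rightarrow> \<^bold>\<diamond> \<phi>) \<in> L"
  and box_4: "(\<^bold>\<box> \<phi> \<^bold>\<rightarrow> \<^bold>\<box> (\<^bold>\<box> \<phi>)) \<in> L"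
proof -
  fix p :: 'p
  have *: "(\<^bold>\<box> (Var p) \<^bold>\<rightarrow> Var p) \<in> L" "(Var p \<^bold>\<rightarrow> \<^bold>\<diamond> (Var p)) \<in> L"
    "(\<^bold>\<diamond> (\<^bold>\<diamond> (Var p)) \<^bold>\<rightarrow> \<^bold>\<diamond> (Var p)) \<in> L" "(\<^bold>\<box> (Var p) \<^bold>\<rightarrow> \<^bold>\<box> (\<^bold>\<box> (Var p))) \<in> L"
    by (rule subsetD[OF CS4_axioms_subset], simp add: CS4_axioms_def)+
  show "(\<^bold>\<box> \<phi> \<^bold>\<rightarrow> \<phi>) \<in> L" "(\<phi> \<^bold>\<rightarrow> \<^bold>\<diamond> \<phi>) \<in> L" "(\<^bold>\<diamond> (\<^bold>\<diamond> \<phi>) \<^bold>\<rightarrow> \<^bold>\<diamond> \<phi>) \<in> L"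
    "(\<^bold>\<box> \<phi> \<^bold>\<rightarrow> \<^bold>\<box> (\<^bold>\<box> \<phi>)) \<in> L"
    using *[THEN substituted, of "\<lambda>_. \<phi>"] by simp_all
qed

lemma dia_disj: "(\<^bold>\<diamond> (\<phi> \<^bold>\<or> \<psi>) \<^bold>\<rightarrow> \<^bold>\<diamond> \<phi> \<^bold>\<or> \<^bold>\<diamond> \<psi>) \<in> L"
proof -
  obtain p q :: 'p and \<sigma> where v: "p \<noteq> q" "\<sigma> p = \<phi>" "\<sigma> q = \<psi>"
    by (rule two_variables)
  have "(\<^bold>\<diamond> (Var p \<^bold>\<or> Var q) \<^bold>\<rightarrow> \<^bold>\<diamond> (Var p) \<^bold>\<or> \<^bold>\<diamond> (Var q)) \<in> L"
    using DP_subset v(1) unfolding DP_def by blast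
  from substituted[OF this, of \<sigma>] show ?thesis by (simp add: v)
qed

lemma not_dia_bot: "(\<^bold>\<not> (\<^bold>\<diamond> \<^bold>\<bottom>)) \<in> L"
  using N_subset by (simp add: N_def)

lemma FS2_instance:
  assumes "FS2 \<subseteq> L"
  shows "((\<^bold>\<diamond> \<phi> \<^bold>\<rightarrow> \<^bold>\<box> \<psi>) \<^bold>\<rightarrow> \<^bold>\<box> (\<phi> \<^bold>\<rightarrow> \<psi>)) \<in> L"
proof -
  obtain p q :: 'p and \<sigma> where v: "p \<noteq> q" "\<sigma> p = \<phi>" "\<sigma> q = \<psi>"
    by (rule two_variables)
  have "((\<^bold>\<diamond> (Var p) \<^bold>\<rightarrow> \<^bold>\<box> (Var q)) \<^bold>\<rightarrow> \<^bold>\<box> (Var p \<^bold>\<rightarrow> Var q)) \<in> L"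
    using assms v(1) unfolding FS2_def by blast
  from substituted[OF this, of \<sigma>] show ?thesis by (simp add: v)
qed

lemma CD_instance:
  assumes "CD \<subseteq> L"
  shows "(\<^bold>\<box> (\<phi> \<^bold>\<or> \<psi>) \<^bold>\<rightarrow> \<^bold>\<box> \<phi> \<^bold>\<or> \<^bold>\<diamond> \<psi>) \<in> L"
proof -
  obtain p q :: 'p and \<sigma> where v: "p \<noteq> q" "\<sigma> p = \<phi>" "\<sigma> q = \<psi>"
    by (rule two_variables)
  have "(\<^bold>\<box> (Var p \<^bold>\<or> Var q) \<^bold>\<rightarrow> \<^bold>\<box> (Var p) \<^bold>\<or> \<^bold>\<diamond> (Var q)) \<in> L"
    using assms v(1) unfolding CD_def by blast
  from substituted[OF this, of \<sigma>] show ?thesis by (simp add: v)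
qed

lemma GD_instance:
  assumes "GD \<subseteq> L"
  shows "((\<phi> \<^bold>\<rightarrow> \<psi>) \<^bold>\<or> (\<psi> \<^bold>\<rightarrow> \<phi>)) \<in> L"
proof -
  obtain p q :: 'p and \<sigma> where v: "p \<noteq> q" "\<sigma> p = \<phi>" "\<sigma> q = \<psi>"
    by (rule two_variables)
  have "((Var p \<^bold>\<rightarrow> Var q) \<^bold>\<or> (Var q \<^bold>\<rightarrow> Var p)) \<in> L"
    using assms v(1) unfolding GD_def by blast
  from substituted[OF this, of \<sigma>] show ?thesis by (simp add: v)
qed

lemma in_logicI: "{\<phi>} \<turnstile> \<psi> \<Longrightarrow> (\<phi> \<^bold>\<rightarrow> \<psi>) \<in> L"
  using deduction derives_empty by blast

lemma box_mono: "(\<phi> \<^bold>\<rightarrow> \<psi>) \<in> L \<Longrightarrow> (\<^bold>\<box> \<phi> \<^bold>\<rightarrow> \<^bold>\<box> \<psi>) \<in> L"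
  using nec_closed mp_closed box_K unfolding nec_closed_def mp_closed_def by blast

lemma dia_mono: "(\<phi> \<^bold>\<rightarrow> \<psi>) \<in> L \<Longrightarrow> (\<^bold>\<diamond> \<phi> \<^bold>\<rightarrow> \<^bold>\<diamond> \<psi>) \<in> L"
  using nec_closed mp_closed dia_K unfolding nec_closed_def mp_closed_def by blast

subsection \<open>Prime theories\<close>

text \<open>Falsum is excluded because prime theories are the worlds of an infallible frame.\<close>

definition prime_theory :: "'p fm set \<Rightarrow> bool" where
  "prime_theory T \<longleftrightarrow> (\<forall>\<phi>. T \<turnstile> \<phi> \<longrightarrow> \<phi> \<in> T) \<and> \<^bold>\<bottom> \<notin> T \<and>
     (\<forall>\<phi> \<psi>. \<phi> \<^bold>\<or> \<psi> \<in> T \<longrightarrow> \<phi> \<in> T \<or> \<psi> \<in> T)"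

lemma prime_derives: "prime_theory T \<Longrightarrow> T \<turnstile> \<phi> \<Longrightarrow> \<phi> \<in> T"
  by (simp add: prime_theory_def)

lemma prime_bot: "prime_theory T \<Longrightarrow> \<^bold>\<bottom> \<notin> T"
  by (simp add: prime_theory_def)

lemma prime_logic: "prime_theory T \<Longrightarrow> \<phi> \<in> L \<Longrightarrow> \<phi> \<in> T"
  by (blast intro: prime_derives derives_logic)

lemma prime_mp: "prime_theory T \<Longrightarrow> (\<phi> \<^bold>\<rightarrow> \<psi>) \<in> T \<Longrightarrow> \<phi> \<in> T \<Longrightarrow> \<psi> \<in> T"
  by (blast intro: prime_derives derives_mp derives_hyp)

lemma prime_logic_mp: "prime_theory T \<Longrightarrow> (\<phi> \<^bold>\<rightarrow> \<psi>) \<in> L \<Longrightarrow> \<phi> \<in> T \<Longrightarrow> \<psi> \<in> T"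
  by (blast intro: prime_mp prime_logic)

lemma conj_elim_logic: "(\<phi> \<^bold>\<and> \<psi> \<^bold>\<rightarrow> \<phi>) \<in> L" "(\<phi> \<^bold>\<and> \<psi> \<^bold>\<rightarrow> \<psi>) \<in> L"
  using IPC_subset conj_elim1 conj_elim2 by blast+

lemma disj_intro_logic: "(\<phi> \<^bold>\<rightarrow> \<phi> \<^bold>\<or> \<psi>) \<in> L" "(\<psi> \<^bold>\<rightarrow> \<phi> \<^bold>\<or> \<psi>) \<in> L"
  using IPC_subset disj_intro1 disj_intro2 by blast+

lemma prime_conj_iff:
  assumes "prime_theory T"
  shows "\<phi> \<^bold>\<and> \<psi> \<in> T \<longleftrightarrow> \<phi> \<in> T \<and> \<psi> \<in> T"
  using prime_logic_mp[OF assms conj_elim_logic(1)] prime_logic_mp[OF assms conj_elim_logic(2)]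
    prime_derives[OF assms derives_conjI] derives_hyp by blast

lemma prime_disj_iff:
  assumes "prime_theory T"
  shows "\<phi> \<^bold>\<or> \<psi> \<in> T \<longleftrightarrow> \<phi> \<in> T \<or> \<psi> \<in> T"
  using prime_logic_mp[OF assms disj_intro_logic(1)] prime_logic_mp[OF assms disj_intro_logic(2)]
    assms unfolding prime_theory_def by blast

section \<open>Directed sets and the extension to prime theories\<close>

definition up_directed :: "'p fm set \<Rightarrow> bool" where
  "up_directed B \<longleftrightarrow> B \<noteq> {} \<and> (\<forall>x\<in>B. \<forall>y\<in>B. \<exists>z\<in>B. (x \<^bold>\<rightarrow> z) \<in> L \<and> (y \<^bold>\<rightarrow> z) \<in> L)"

text \<open>Directedness replaces closure under conjunction or disjunction, which syntactic images
  fail: \<open>\<box> \<phi> \<or> \<box> \<psi>\<close> is not a boxed formula, yet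
  \<open>\<box> (\<phi> \<or> \<psi>)\<close> bounds both disjuncts.\<close>

definition down_directed :: "'p fm set \<Rightarrow> bool" where
  "down_directed D \<longleftrightarrow> D \<noteq> {} \<and> (\<forall>x\<in>D. \<forall>y\<in>D. \<exists>z\<in>D. (z \<^bold>\<rightarrow> x) \<in> L \<and> (z \<^bold>\<rightarrow> y) \<in> L)"

lemma derives_logic_mp: "(\<phi> \<^bold>\<rightarrow> \<psi>) \<in> L \<Longrightarrow> A \<turnstile> \<phi> \<Longrightarrow> A \<turnstile> \<psi>"
  by (blast intro: derives_mp derives_logic)

lemma imp_refl_logic: "(\<phi> \<^bold>\<rightarrow> \<phi>) \<in> L"
  using derives_refl derives_empty by blast

lemma derives_imp_trans: "(\<chi> \<^bold>\<rightarrow> \<phi>) \<in> L \<Longrightarrow> A \<turnstile> \<phi> \<^bold>\<rightarrow> \<psi> \<Longrightarrow> A \<turnstile> \<chi> \<^bold>\<rightarrow> \<psi>"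
  by (rule deduction, rule derives_mp, erule derives_mono, blast)
    (blast intro: derives_logic_mp derives_hyp)

text \<open>All uses of \<open>D\<close> in a derivation compress to one member: at modus ponens the
  members found for the two premises are replaced by a common lower bound.\<close>

lemma derives_down_directed:
  assumes "down_directed D" "A \<union> D \<turnstile> \<phi>"
  shows "\<exists>d\<in>D. A \<turnstile> d \<^bold>\<rightarrow> \<phi>"
  using assms(2)
proof (induction rule: derives.induct)
  case (derives_logic \<phi>)
  then show ?case
    using assms(1) derives_weaken derives.derives_logic unfolding down_directed_def by blast
next
  case (derives_hyp \<phi>)
  then show ?case
    using assms(1) derives_weaken derives_refl derives.derives_hyp
    unfolding down_directed_def by blast
next
  case (derives_mp \<phi> \<psi>)
  then obtain d e where "d \<in> D" "A \<turnstile> d \<^bold>\<rightarrow> \<phi> \<^bold>\<rightarrow> \<psi>" "e \<in> D" "A \<turnstile> e \<^bold>\<rightarrow> \<phi>"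
    by blast
  moreover from this obtain c where "c \<in> D" "(c \<^bold>\<rightarrow> d) \<in> L" "(c \<^bold>\<rightarrow> e) \<in> L"
    using assms(1) unfolding down_directed_def by blast
  ultimately have "A \<turnstile> c \<^bold>\<rightarrow> \<phi> \<^bold>\<rightarrow> \<psi>" "A \<turnstile> c \<^bold>\<rightarrow> \<phi>"
    by (blast intro: derives_imp_trans)+
  then have "A \<turnstile> c \<^bold>\<rightarrow> \<psi>"
    using derives_IPC[OF ax_S] derives.derives_mp by blast
  with \<open>c \<in> D\<close> show ?case by blast
qed

text \<open>At modus ponens the larger of the two chain members derives both premises.\<close>

lemma derives_Union_chain:
  assumes "\<Union>C \<turnstile> \<phi>" "C \<noteq> {}" "subset.chain \<A> C"
  shows "\<exists>T\<in>C. T \<turnstile> \<phi>"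
  using assms(1)
proof (induction rule: derives.induct)
  case (derives_mp \<phi> \<psi>)
  then obtain T U where "T \<in> C" "T \<turnstile> \<phi> \<^bold>\<rightarrow> \<psi>" "U \<in> C" "U \<turnstile> \<phi>"
    by blast
  moreover have "T \<subseteq> U \<or> U \<subseteq> T"
    using calculation assms(3) unfolding subset_chain_def by blast
  ultimately show ?case
    using derives_mono derives.derives_mp by meson
qed (use assms(2) in \<open>auto intro: derives.intros\<close>)

text \<open>Zorn's lemma gives a maximal superset of \<open>A\<close> deriving no member of
  \<open>B\<close>. Directedness of \<open>B\<close> replaces the single omitted formula of
  Lindenbaum's construction.\<close>

theorem prime_extension:
  assumes B: "up_directed B" and A: "\<And>b. b \<in> B \<Longrightarrow> \<not> A \<turnstile> b"
  obtains T where "prime_theory T" "A \<subseteq> T" "T \<inter> B = {}"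
proof -
  define \<A> where "\<A> = {T. A \<subseteq> T \<and> (\<forall>b\<in>B. \<not> T \<turnstile> b)}"
  have "\<A> \<noteq> {}"
    using A by (auto simp: \<A>_def)
  moreover have "\<Union>C \<in> \<A>" if "C \<noteq> {}" "subset.chain \<A> C" for C
  proof -
    have sub: "C \<subseteq> \<A>"
      using that(2) by (simp add: subset_chain_def)
    then have "A \<subseteq> \<Union>C"
      using that(1) by (auto simp: \<A>_def)
    moreover have "\<not> \<Union>C \<turnstile> b" if "b \<in> B" for b
      using derives_Union_chain[OF _ \<open>C \<noteq> {}\<close> \<open>subset.chain \<A> C\<close>, of b] sub that
      by (auto simp: \<A>_def)
    ultimately show ?thesis
      by (simp add: \<A>_def)
  qed
  ultimately obtain T where T: "T \<in> \<A>" and max: "\<And>X. X \<in> \<A> \<Longrightarrow> T \<subseteq> X \<Longrightarrow> X = T"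
    using subset_Zorn_nonempty[of \<A>] by blast
  have AT: "A \<subseteq> T" and TB: "\<And>b. b \<in> B \<Longrightarrow> \<not> T \<turnstile> b"
    using T by (auto simp: \<A>_def)
  \<comment> \<open>By maximality, adjoining any further formula makes some member of
    \<open>B\<close> derivable.\<close>
  have new: "\<exists>b\<in>B. insert \<phi> T \<turnstile> b" if "\<phi> \<notin> T" for \<phi>
    using max[of "insert \<phi> T"] that AT unfolding \<A>_def by blast
  have closed: "\<phi> \<in> T" if "T \<turnstile> \<phi>" for \<phi>
  proof (rule ccontr)
    assume "\<phi> \<notin> T"
    then obtain b where "b \<in> B" "insert \<phi> T \<turnstile> b"
      using new by blast
    then show False
      using TB derives_mp[OF deduction that] by blast
  qed
  \<comment> \<open>An inconsistent \<open>T\<close> would derive everything, in particular a member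
    of \<open>B\<close>, which is nonempty.\<close>
  have "\<^bold>\<bottom> \<notin> T"
  proof
    assume "\<^bold>\<bottom> \<in> T"
    then have "T \<turnstile> b" for b
      by (rule derives_mp[OF derives_IPC[OF ex_falso] derives_hyp])
    then show False
      using B TB unfolding up_directed_def by blast
  qed
  moreover have "\<phi> \<in> T \<or> \<psi> \<in> T" if "\<phi> \<^bold>\<or> \<psi> \<in> T" for \<phi> \<psi>
  proof (rule ccontr)
    assume "\<not> (\<phi> \<in> T \<or> \<psi> \<in> T)"
    then obtain x y where xy: "x \<in> B" "insert \<phi> T \<turnstile> x" "y \<in> B" "insert \<psi> T \<turnstile> y"
      using new by blast
    \<comment> \<open>The disjuncts may lead to different members of \<open>B\<close>; a common
      upper bound follows from both, hence from the disjunction.\<close>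
    then obtain z where "z \<in> B" "(x \<^bold>\<rightarrow> z) \<in> L" "(y \<^bold>\<rightarrow> z) \<in> L"
      using B unfolding up_directed_def by blast
    then show False
      using xy TB derives_disjE[OF derives_hyp[OF that], of z] by (blast intro: derives_logic_mp)
  qed
  ultimately have "prime_theory T"
    using closed unfolding prime_theory_def by blast
  moreover have "T \<inter> B = {}"
    using TB derives_hyp by blast
  ultimately show thesis
    using that AT by blast
qed

lemma up_directed_singleton: "up_directed {\<phi>}"
  using imp_refl_logic by (simp add: up_directed_def)

lemma down_directed_singleton: "down_directed {\<phi>}"
  using imp_refl_logic by (simp add: down_directed_def)

lemma down_directed_prime:
  assumes "prime_theory T"
  shows "down_directed T"
  unfolding down_directed_def
  using prime_logic[OF assms imp_refl_logic] prime_conj_iff[OF assms] conj_elim_logic by blast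

lemma down_directed_Dia:
  assumes "prime_theory T"
  shows "down_directed (Dia ` T)"
  using down_directed_prime[OF assms] dia_mono unfolding down_directed_def by blast

text \<open>Consistency makes the complement nonempty, and primeness closes it under disjunction,
  which is an upper bound.\<close>

lemma up_directed_compl_prime:
  assumes "prime_theory T"
  shows "up_directed (- T)"
  unfolding up_directed_def
  using prime_bot[OF assms] prime_disj_iff[OF assms] disj_intro_logic by blast

lemma up_directed_Box_compl_prime:
  assumes "prime_theory T"
  shows "up_directed (Box ` (- T))"
  using up_directed_compl_prime[OF assms] box_mono unfolding up_directed_def by blast

lemma prime_dia_bot: "prime_theory T \<Longrightarrow> \<^bold>\<bottom> \<notin> dia_inv T"
  using prime_logic_mp[OF _ not_dia_bot] prime_bot by (auto simp: dia_inv_def)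

lemma prime_dia_disj: "prime_theory T \<Longrightarrow> \<phi> \<^bold>\<or> \<psi> \<in> dia_inv T \<Longrightarrow> \<phi> \<in> dia_inv T \<or> \<psi> \<in> dia_inv T"
  using prime_logic_mp[OF _ dia_disj] prime_disj_iff by (auto simp: dia_inv_def)

text \<open>N puts falsum into this complement, and DP closes it under disjunction.\<close>

lemma up_directed_compl_dia_inv:
  assumes "prime_theory T"
  shows "up_directed (- dia_inv T)"
  unfolding up_directed_def
  using prime_dia_bot[OF assms] prime_dia_disj[OF assms] disj_intro_logic by blast

text \<open>Necessitation handles the theorems of \<open>L\<close>, and axiom K for box handles
  modus ponens.\<close>

lemma prime_box_derives:
  assumes "prime_theory T" "box_inv T \<turnstile> \<phi>"
  shows "\<^bold>\<box> \<phi> \<in> T"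
  using assms(2)
proof (induction rule: derives.induct)
  case (derives_logic \<phi>)
  then show ?case using nec_closed prime_logic[OF assms(1)] by (simp add: nec_closed_def)
next
  case (derives_hyp \<phi>)
  then show ?case by (simp add: box_inv_def)
next
  case (derives_mp \<phi> \<psi>)
  then show ?case using prime_mp prime_logic_mp[OF _ box_K] assms(1) by blast
qed

section \<open>Canonical accessibility and its witnesses\<close>

lemma acc_refl: "prime_theory T \<Longrightarrow> acc T T"
  using prime_logic_mp[OF _ box_T] prime_logic_mp[OF _ dia_T]
  by (auto simp: acc_def box_inv_def dia_inv_def)

lemma acc_trans: "prime_theory T \<Longrightarrow> acc T U \<Longrightarrow> acc U W \<Longrightarrow> acc T W"
  using prime_logic_mp[OF _ box_4] prime_logic_mp[OF _ dia_4]
  unfolding acc_def box_inv_def dia_inv_def by blast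

text \<open>A singleton \<open>D\<close> gives the diamond case of the truth lemma, and a whole
  prime theory gives forth--up confluence. If \<open>box_inv T\<close> and some \<open>d\<close> in
  \<open>D\<close> derived a forbidden \<open>b\<close>, axiom K for diamond would put
  \<open>\<diamond> b\<close> into \<open>T\<close>.\<close>

lemma dia_witness:
  assumes T: "prime_theory T" and D: "down_directed D" "D \<subseteq> dia_inv T"
  obtains U where "prime_theory U" "D \<subseteq> U" "acc T U"
proof -
  have "\<not> box_inv T \<union> D \<turnstile> b" if "b \<in> - dia_inv T" for b
  proof
    assume "box_inv T \<union> D \<turnstile> b"
    then obtain d where "d \<in> D" "box_inv T \<turnstile> d \<^bold>\<rightarrow> b"
      using derives_down_directed[OF D(1)] by blast
    then have "\<^bold>\<diamond> d \<^bold>\<rightarrow> \<^bold>\<diamond> b \<in> T" "\<^bold>\<diamond> d \<in> T"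
      using prime_logic_mp[OF T dia_K prime_box_derives[OF T]] D(2) by (auto simp: dia_inv_def)
    then show False
      using prime_mp[OF T] that by (auto simp: dia_inv_def)
  qed
  then obtain U where "prime_theory U" "box_inv T \<union> D \<subseteq> U" "U \<inter> - dia_inv T = {}"
    using prime_extension[OF up_directed_compl_dia_inv[OF T]] by metis
  then show thesis
    using that[of U] unfolding acc_def by blast
qed

text \<open>The theory sought contains \<open>T\<close> and \<open>\<diamond> \<phi>\<close> for
  \<open>\<phi> \<in> U\<close>, and avoids \<open>\<box> \<psi>\<close> for
  \<open>\<psi> \<notin> U\<close>. An obstruction is some
  \<open>\<diamond> \<phi> \<rightarrow> \<box> \<psi>\<close> in \<open>T\<close>, which FS2 turns
  into \<open>\<phi> \<rightarrow> \<psi>\<close> in \<open>U\<close>.\<close>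

lemma FS2_extension:
  assumes "FS2 \<subseteq> L" and T: "prime_theory T" and U: "prime_theory U" "box_inv T \<subseteq> U"
  obtains T' where "prime_theory T'" "T \<subseteq> T'" "acc T' U"
proof -
  have "\<not> T \<union> Dia ` U \<turnstile> b" if "b \<in> Box ` (- U)" for b
  proof
    assume "T \<union> Dia ` U \<turnstile> b"
    then obtain \<phi> \<psi> where "\<phi> \<in> U" "\<psi> \<notin> U" "T \<turnstile> \<^bold>\<diamond> \<phi> \<^bold>\<rightarrow> \<^bold>\<box> \<psi>"
      using derives_down_directed[OF down_directed_Dia[OF U(1)]] \<open>b \<in> Box ` (- U)\<close> by blast
    then have "\<^bold>\<box> (\<phi> \<^bold>\<rightarrow> \<psi>) \<in> T"
      using prime_derives[OF T] prime_logic_mp[OF T] FS2_instance[OF assms(1)] by blast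
    then have "\<phi> \<^bold>\<rightarrow> \<psi> \<in> U"
      using U(2) by (auto simp: box_inv_def)
    then show False
      using prime_mp U(1) \<open>\<phi> \<in> U\<close> \<open>\<psi> \<notin> U\<close> by blast
  qed
  then obtain T' where "prime_theory T'" "T \<union> Dia ` U \<subseteq> T'" "T' \<inter> Box ` (- U) = {}"
    using prime_extension[OF up_directed_Box_compl_prime[OF U(1)]] by metis
  then show thesis
    using that[of T'] unfolding acc_def box_inv_def dia_inv_def by blast
qed

lemma CD_witness:
  assumes "CD \<subseteq> L" and T: "prime_theory T" and X: "up_directed X" "\<And>x. x \<in> X \<Longrightarrow> \<^bold>\<box> x \<notin> T"
  obtains U where "prime_theory U" "U \<inter> X = {}" "acc T U"
proof -
  \<comment> \<open>Both \<open>X\<close> and the complement of \<open>dia_inv T\<close> must be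
    avoided. Disjunctions of their members merge them into one directed set, and have the shape to
    which CD applies under a box.\<close>
  define B where "B = {x \<^bold>\<or> \<chi> | x \<chi>. x \<in> X \<and> \<chi> \<notin> dia_inv T}"
  have "up_directed B"
    unfolding up_directed_def
  proof (intro conjI ballI)
    show "B \<noteq> {}"
      using X(1) prime_dia_bot[OF T] unfolding B_def up_directed_def by blast
    fix b c
    assume "b \<in> B" "c \<in> B"
    then obtain x \<chi> y \<xi> where bc: "b = x \<^bold>\<or> \<chi>" "c = y \<^bold>\<or> \<xi>" "x \<in> X" "y \<in> X"
      "\<chi> \<notin> dia_inv T" "\<xi> \<notin> dia_inv T"
      unfolding B_def by blast
    obtain z where z: "z \<in> X" "(x \<^bold>\<rightarrow> z) \<in> L" "(y \<^bold>\<rightarrow> z) \<in> L"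
      using X(1) bc(3,4) unfolding up_directed_def by blast
    have disj: "(\<phi> \<^bold>\<or> \<psi> \<^bold>\<rightarrow> z \<^bold>\<or> \<chi> \<^bold>\<or> \<xi>) \<in> L"
      if "(\<phi> \<^bold>\<rightarrow> z) \<in> L" "(\<psi> \<^bold>\<rightarrow> \<chi> \<^bold>\<or> \<xi>) \<in> L" for \<phi> \<psi>
    proof (rule in_logicI, rule derives_disjE)
      show "{\<phi> \<^bold>\<or> \<psi>} \<turnstile> \<phi> \<^bold>\<or> \<psi>"
        by (simp add: derives_hyp)
      show "insert \<phi> {\<phi> \<^bold>\<or> \<psi>} \<turnstile> z \<^bold>\<or> \<chi> \<^bold>\<or> \<xi>"
        by (rule derives_logic_mp[OF disj_intro_logic(1)], rule derives_logic_mp[OF that(1)])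
          (simp add: derives_hyp)
      show "insert \<psi> {\<phi> \<^bold>\<or> \<psi>} \<turnstile> z \<^bold>\<or> \<chi> \<^bold>\<or> \<xi>"
        by (rule derives_logic_mp[OF disj_intro_logic(2)], rule derives_logic_mp[OF that(2)])
          (simp add: derives_hyp)
    qed
    \<comment> \<open>The bound \<open>z\<close> stays in \<open>X\<close>, and DP keeps
      \<open>\<chi> \<or> \<xi>\<close> outside \<open>dia_inv T\<close>.\<close>
    have "z \<^bold>\<or> \<chi> \<^bold>\<or> \<xi> \<in> B"
      using z(1) bc(5,6) prime_dia_disj[OF T] unfolding B_def by blast
    then show "\<exists>d\<in>B. (b \<^bold>\<rightarrow> d) \<in> L \<and> (c \<^bold>\<rightarrow> d) \<in> L"
      using disj[OF z(2) disj_intro_logic(1)] disj[OF z(3) disj_intro_logic(2)] bc(1,2) by blast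
  qed
  moreover have "\<not> box_inv T \<turnstile> b" if "b \<in> B" for b
  proof
    assume "box_inv T \<turnstile> b"
    moreover obtain x \<chi> where b: "b = x \<^bold>\<or> \<chi>" "x \<in> X" "\<chi> \<notin> dia_inv T"
      using \<open>b \<in> B\<close> unfolding B_def by blast
    ultimately have "\<^bold>\<box> x \<^bold>\<or> \<^bold>\<diamond> \<chi> \<in> T"
      using prime_box_derives[OF T] prime_logic_mp[OF T] CD_instance[OF assms(1)] by blast
    then show False
      using b X(2) prime_disj_iff[OF T] by (auto simp: dia_inv_def)
  qed
  ultimately obtain U where U: "prime_theory U" "box_inv T \<subseteq> U" "U \<inter> B = {}"
    using prime_extension by metis
  \<comment> \<open>A member of \<open>U\<close> would bring any disjunction containing it into
    \<open>U\<close>: falsum, outside \<open>dia_inv T\<close> by N, is a partner for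
    \<open>x\<close>, and some element of the nonempty \<open>X\<close> is one for
    \<open>\<chi>\<close>.\<close>
  have "x \<notin> U" if "x \<in> X" for x
    using that U(3) prime_dia_bot[OF T] prime_disj_iff[OF U(1)] unfolding B_def by blast
  moreover have "\<chi> \<in> dia_inv T" if "\<chi> \<in> U" for \<chi>
    using that U(3) X(1) prime_disj_iff[OF U(1)] unfolding B_def up_directed_def by blast
  ultimately show thesis
    using that U(1,2) unfolding acc_def by blast
qed

subsection \<open>The canonical model\<close>

text \<open>The map \<open>f\<close> copies theories into the given type of worlds; where it is
  injective, a world determines its theory.\<close>

definition canonical_frame :: "('p fm set \<Rightarrow> 'w) \<Rightarrow> 'w frame" where
  "canonical_frame f =
     \<lparr>worlds = f ` Collect prime_theory,
      fallible = {},
      ile = {(f T, f U) | T U. prime_theory T \<and> prime_theory U \<and> T \<subseteq> U},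
      mle = {(f T, f U) | T U. prime_theory T \<and> prime_theory U \<and> acc T U}\<rparr>"

definition canonical_valuation :: "('p fm set \<Rightarrow> 'w) \<Rightarrow> 'p \<Rightarrow> 'w set" where
  "canonical_valuation f p = f ` {T. prime_theory T \<and> Var p \<in> T}"

context
  fixes f :: "'p fm set \<Rightarrow> 'w"
  assumes inj: "inj f"
begin

lemma fallible_canonical [simp]: "fallible (canonical_frame f) = {}"
  by (simp add: canonical_frame_def)

lemma worlds_canonical: "worlds (canonical_frame f) = f ` Collect prime_theory"
  by (simp add: canonical_frame_def)

lemma ile_canonical:
  "(x, y) \<in> ile (canonical_frame f) \<longleftrightarrow>
     (\<exists>T U. x = f T \<and> y = f U \<and> prime_theory T \<and> prime_theory U \<and> T \<subseteq> U)"
  by (simp add: canonical_frame_def)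

lemma mle_canonical:
  "(x, y) \<in> mle (canonical_frame f) \<longleftrightarrow>
     (\<exists>T U. x = f T \<and> y = f U \<and> prime_theory T \<and> prime_theory U \<and> acc T U)"
  by (simp add: canonical_frame_def)

lemma ile_canonical_from:
  assumes "prime_theory T"
  shows "(f T, y) \<in> ile (canonical_frame f) \<longleftrightarrow> (\<exists>U. y = f U \<and> prime_theory U \<and> T \<subseteq> U)"
  using assms injD[OF inj] unfolding ile_canonical by blast

lemma mle_canonical_from:
  assumes "prime_theory T"
  shows "(f T, y) \<in> mle (canonical_frame f) \<longleftrightarrow> (\<exists>U. y = f U \<and> prime_theory U \<and> acc T U)"
  using assms injD[OF inj] unfolding mle_canonical by blast

lemma bi_intuitionistic_canonical: "bi_intuitionistic_frame (canonical_frame f)"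
  unfolding bi_intuitionistic_frame_def preorder_on_def refl_on_def trans_def
proof (intro conjI)
  show "ile (canonical_frame f) \<subseteq> worlds (canonical_frame f) \<times> worlds (canonical_frame f)"
    "mle (canonical_frame f) \<subseteq> worlds (canonical_frame f) \<times> worlds (canonical_frame f)"
    by (auto simp: canonical_frame_def)
  show "\<forall>x\<in>worlds (canonical_frame f). (x, x) \<in> ile (canonical_frame f)"
    by (auto simp: worlds_canonical ile_canonical_from)
  show "\<forall>x\<in>worlds (canonical_frame f). (x, x) \<in> mle (canonical_frame f)"
    by (auto simp: worlds_canonical mle_canonical_from acc_refl)
  show "\<forall>x y z. (x, y) \<in> ile (canonical_frame f) \<longrightarrow> (y, z) \<in> ile (canonical_frame f) \<longrightarrow>
      (x, z) \<in> ile (canonical_frame f)"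
    unfolding ile_canonical using injD[OF inj] by (metis subset_trans)
  show "\<forall>x y z. (x, y) \<in> mle (canonical_frame f) \<longrightarrow> (y, z) \<in> mle (canonical_frame f) \<longrightarrow>
      (x, z) \<in> mle (canonical_frame f)"
    unfolding mle_canonical using injD[OF inj] acc_trans by metis
qed simp_all

lemma infallible_canonical: "infallible (canonical_frame f)"
  by (simp add: infallible_def)

lemma forth_up_canonical: "forth_up_confluent (canonical_frame f)"
  unfolding forth_up_confluent_def
proof (intro allI impI)
  fix w w' v
  assume "(w, w') \<in> ile (canonical_frame f)" "(w, v) \<in> mle (canonical_frame f)"
  then obtain T T' U where *: "w = f T" "w' = f T'" "v = f U" "T \<subseteq> T'" "acc T U"
    "prime_theory T" "prime_theory T'" "prime_theory U"
    using injD[OF inj] unfolding ile_canonical mle_canonical by metis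
  \<comment> \<open>The diamond half of \<open>acc\<close> survives enlarging \<open>T\<close>, so
    all of \<open>U\<close> can serve as \<open>D\<close> in \<open>dia_witness\<close>.\<close>
  have "U \<subseteq> dia_inv T'"
    using * unfolding acc_def dia_inv_def by blast
  then obtain U' where "prime_theory U'" "U \<subseteq> U'" "acc T' U'"
    using dia_witness *(7) down_directed_prime[OF *(8)] by metis
  then show "\<exists>v'. (v, v') \<in> ile (canonical_frame f) \<and> (w', v') \<in> mle (canonical_frame f)"
    using * unfolding ile_canonical mle_canonical by blast
qed

lemma back_up_canonical:
  assumes "FS2 \<subseteq> L"
  shows "back_up_confluent (canonical_frame f)"
  unfolding back_up_confluent_def
proof (intro allI impI)
  fix w v v'
  assume "(w, v) \<in> mle (canonical_frame f)" "(v, v') \<in> ile (canonical_frame f)"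
  then obtain T U U' where *: "w = f T" "v = f U" "v' = f U'" "acc T U" "U \<subseteq> U'"
    "prime_theory T" "prime_theory U" "prime_theory U'"
    using injD[OF inj] unfolding ile_canonical mle_canonical by metis
  \<comment> \<open>Enlarging \<open>U\<close> preserves the box half of \<open>acc\<close> but may
    break the diamond half; enlarging \<open>T\<close> by \<open>FS2_extension\<close> restores
    it.\<close>
  have "box_inv T \<subseteq> U'"
    using * unfolding acc_def by blast
  then obtain T' where "prime_theory T'" "T \<subseteq> T'" "acc T' U'"
    using FS2_extension[OF assms *(6,8)] by metis
  then show "\<exists>w'. (w, w') \<in> ile (canonical_frame f) \<and> (w', v') \<in> mle (canonical_frame f)"
    using * unfolding ile_canonical mle_canonical by blast
qed

lemma forth_down_canonical:
  assumes "CD \<subseteq> L"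
  shows "forth_down_confluent (canonical_frame f)"
  unfolding forth_down_confluent_def
proof (intro allI impI)
  fix w v v'
  assume "(w, v) \<in> ile (canonical_frame f)" "(v, v') \<in> mle (canonical_frame f)"
  then obtain T U U' where *: "w = f T" "v = f U" "v' = f U'" "T \<subseteq> U" "acc U U'"
    "prime_theory T" "prime_theory U" "prime_theory U'"
    using injD[OF inj] unfolding ile_canonical mle_canonical by metis
  \<comment> \<open>The set to avoid is the complement of \<open>U'\<close>, so that the modal
    successor found lies inside \<open>U'\<close>.\<close>
  have "\<^bold>\<box> x \<notin> T" if "x \<in> - U'" for x
    using * that unfolding acc_def box_inv_def by blast
  then obtain T' where "prime_theory T'" "T' \<inter> - U' = {}" "acc T T'"
    using CD_witness[OF assms *(6) up_directed_compl_prime[OF *(8)]] by metis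
  then show "\<exists>w'. (w, w') \<in> mle (canonical_frame f) \<and> (w', v') \<in> ile (canonical_frame f)"
    using * unfolding ile_canonical mle_canonical by blast
qed

lemma upward_linear_canonical:
  assumes "GD \<subseteq> L"
  shows "upward_linear (canonical_frame f)"
  unfolding upward_linear_def
proof (intro allI impI)
  fix w u v
  assume "(w, u) \<in> ile (canonical_frame f)" "(w, v) \<in> ile (canonical_frame f)"
  then obtain T U W where *: "u = f U" "v = f W" "T \<subseteq> U" "T \<subseteq> W"
    "prime_theory T" "prime_theory U" "prime_theory W"
    using injD[OF inj] unfolding ile_canonical by metis
  have "U \<subseteq> W \<or> W \<subseteq> U"
  proof (rule ccontr)
    assume "\<not> (U \<subseteq> W \<or> W \<subseteq> U)"
    then obtain \<phi> \<psi> where "\<phi> \<in> U" "\<phi> \<notin> W" "\<psi> \<in> W" "\<psi> \<notin> U"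
      by blast
    \<comment> \<open>One implication of the GD instance lies in the prime theory \<open>T\<close>,
      hence in both extensions, and moves a formula into the theory that omits it.\<close>
    moreover have "\<phi> \<^bold>\<rightarrow> \<psi> \<in> T \<or> \<psi> \<^bold>\<rightarrow> \<phi> \<in> T"
      using prime_logic[OF *(5) GD_instance[OF assms]] prime_disj_iff[OF *(5)] by blast
    ultimately show False
      using * prime_mp by blast
  qed
  then show "(u, v) \<in> ile (canonical_frame f) \<or> (v, u) \<in> ile (canonical_frame f)"
    using * unfolding ile_canonical by blast
qed

lemma valuation_canonical: "valuation (canonical_frame f) (canonical_valuation f)"
  using injD[OF inj]
  unfolding valuation_def canonical_valuation_def ile_canonical worlds_canonical
  by (auto simp: image_iff)

text \<open>FS2 and CD offer two ways to refute a box: the first passes to an extension of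
  \<open>T\<close>, the second stays at \<open>T\<close>.\<close>

theorem truth:
  assumes "FS2 \<subseteq> L \<or> CD \<subseteq> L" "prime_theory T"
  shows "sat (canonical_frame f) (canonical_valuation f) (f T) \<phi> \<longleftrightarrow> \<phi> \<in> T"
  using assms(2)
proof (induction \<phi> arbitrary: T)
  case (Var p)
  then show ?case
    using injD[OF inj] by (auto simp: canonical_valuation_def)
next
  case Bot
  then show ?case by (simp add: prime_bot)
next
  case (And \<phi> \<psi>)
  then show ?case by (simp add: prime_conj_iff)
next
  case (Or \<phi> \<psi>)
  then show ?case by (simp add: prime_disj_iff)
next
  case (Imp \<phi> \<psi>)
  have "sat (canonical_frame f) (canonical_valuation f) (f T) (\<phi> \<^bold>\<rightarrow> \<psi>) \<longleftrightarrow>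
      (\<forall>U. prime_theory U \<longrightarrow> T \<subseteq> U \<longrightarrow> \<phi> \<in> U \<longrightarrow> \<psi> \<in> U)"
    using Imp by (auto simp: ile_canonical_from)
  moreover have "\<exists>U. prime_theory U \<and> T \<subseteq> U \<and> \<phi> \<in> U \<and> \<psi> \<notin> U" if "\<phi> \<^bold>\<rightarrow> \<psi> \<notin> T"
  proof -
    have "\<not> insert \<phi> T \<turnstile> b" if "b \<in> {\<psi>}" for b
      using \<open>\<phi> \<^bold>\<rightarrow> \<psi> \<notin> T\<close> that deduction prime_derives[OF Imp.prems] by blast
    then obtain U where "prime_theory U" "insert \<phi> T \<subseteq> U" "U \<inter> {\<psi>} = {}"
      using prime_extension[OF up_directed_singleton] by metis
    then show ?thesis by blast
  qed
  ultimately show ?case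
    using prime_mp by blast
next
  case (Dia \<phi>)
  have "sat (canonical_frame f) (canonical_valuation f) (f T) (\<^bold>\<diamond> \<phi>) \<longleftrightarrow>
      (\<exists>U. prime_theory U \<and> acc T U \<and> \<phi> \<in> U)"
    using Dia sat_Dia_iff[OF bi_intuitionistic_canonical valuation_canonical forth_up_canonical,
        of "f T" \<phi>]
    by (auto simp: worlds_canonical mle_canonical_from simp del: sat.simps)
  moreover have "\<exists>U. prime_theory U \<and> acc T U \<and> \<phi> \<in> U" if "\<^bold>\<diamond> \<phi> \<in> T"
    using dia_witness[OF Dia.prems down_directed_singleton[of \<phi>]] that
    by (auto simp: dia_inv_def)
  ultimately show ?case
    unfolding acc_def dia_inv_def by blast
next
  case (Box \<phi>)
  have "sat (canonical_frame f) (canonical_valuation f) (f T) (\<^bold>\<box> \<phi>) \<longleftrightarrow>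
      (\<forall>T' U. prime_theory T' \<longrightarrow> T \<subseteq> T' \<longrightarrow> prime_theory U \<longrightarrow> acc T' U \<longrightarrow> \<phi> \<in> U)"
    unfolding sat.simps ile_canonical_from[OF Box.prems] using mle_canonical_from Box.IH by metis
  moreover have "\<exists>T' U. prime_theory T' \<and> T \<subseteq> T' \<and> prime_theory U \<and> acc T' U \<and> \<phi> \<notin> U"
    if "\<^bold>\<box> \<phi> \<notin> T"
    using assms(1)
  proof
    \<comment> \<open>The theory \<open>U\<close> omitting \<open>\<phi>\<close> comes first; it
      need not be accessible from \<open>T\<close>, and \<open>T'\<close> is then built below it in
      the modal order.\<close>
    assume FS2: "FS2 \<subseteq> L"
    have "\<not> box_inv T \<turnstile> b" if "b \<in> {\<phi>}" for b
      using \<open>\<^bold>\<box> \<phi> \<notin> T\<close> that prime_box_derives[OF Box.prems] by blast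
    then obtain U where U: "prime_theory U" "box_inv T \<subseteq> U" "U \<inter> {\<phi>} = {}"
      using prime_extension[OF up_directed_singleton] by metis
    then obtain T' where "prime_theory T'" "T \<subseteq> T'" "acc T' U"
      using FS2_extension[OF FS2 Box.prems] by metis
    then show ?thesis
      using U by blast
  next
    \<comment> \<open>Here \<open>U\<close> is a modal successor of \<open>T\<close> itself, so
      \<open>T\<close> also serves as \<open>T'\<close>.\<close>
    assume CD: "CD \<subseteq> L"
    have "\<^bold>\<box> x \<notin> T" if "x \<in> {\<phi>}" for x
      using \<open>\<^bold>\<box> \<phi> \<notin> T\<close> that by simp
    then obtain U where "prime_theory U" "U \<inter> {\<phi>} = {}" "acc T U"
      using CD_witness[OF CD Box.prems up_directed_singleton] by metis
    then show ?thesis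
      using Box.prems by blast
  qed
  ultimately show ?case
    unfolding acc_def box_inv_def by blast
qed

end

end

section \<open>The four logics as instances, and completeness\<close>

lemma extend_is_logic: "is_logic (L \<^bold>+ A)"
  and extend_mp_closed: "mp_closed (L \<^bold>+ A)"
  and extend_nec_closed: "nec_closed (L \<^bold>+ A)"
  unfolding extend_def is_logic_def mp_closed_def nec_closed_def by blast+

lemma extend_base: "L \<subseteq> L \<^bold>+ A"
  and extend_axioms: "A \<subseteq> L \<^bold>+ A"
  unfolding extend_def by blast+

lemma extend_subsetI: "B \<subseteq> L \<union> A \<Longrightarrow> B \<subseteq> L \<^bold>+ A"
  by (erule subset_trans) (rule Un_least[OF extend_base extend_axioms])

lemma logic_of_closed:
  "is_logic (logic_of \<Lambda>)" "mp_closed (logic_of \<Lambda>)" "nec_closed (logic_of \<Lambda>)"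
  by (cases \<Lambda>; simp add: IS4_def S4I_def GS4_def GS4c_def extend_is_logic extend_mp_closed
      extend_nec_closed)+

lemma CS4_subset_logic_of: "CS4 \<subseteq> logic_of \<Lambda>"
  and DP_subset_logic_of: "DP \<subseteq> logic_of \<Lambda>"
  and N_subset_logic_of: "N \<subseteq> logic_of \<Lambda>"
  and FS2_subset_logic_of: "\<Lambda> \<noteq> Name_S4I \<Longrightarrow> FS2 \<subseteq> logic_of \<Lambda>"
  and CD_subset_logic_of: "\<Lambda> = Name_S4I \<or> \<Lambda> = Name_GS4c \<Longrightarrow> CD \<subseteq> logic_of \<Lambda>"
  and GD_subset_logic_of: "\<Lambda> = Name_GS4 \<or> \<Lambda> = Name_GS4c \<Longrightarrow> GD \<subseteq> logic_of \<Lambda>"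
proof -
  have IS4: "CS4 \<subseteq> (IS4 :: 'p fm set)" "DP \<subseteq> (IS4 :: 'p fm set)" "N \<subseteq> (IS4 :: 'p fm set)"
    "FS2 \<subseteq> (IS4 :: 'p fm set)"
    and S4I: "CS4 \<subseteq> (S4I :: 'p fm set)" "DP \<subseteq> (S4I :: 'p fm set)" "N \<subseteq> (S4I :: 'p fm set)"
    "CD \<subseteq> (S4I :: 'p fm set)"
    and GS4: "IS4 \<subseteq> (GS4 :: 'p fm set)" "GD \<subseteq> (GS4 :: 'p fm set)"
    and GS4c: "GS4 \<subseteq> (GS4c :: 'p fm set)" "CD \<subseteq> (GS4c :: 'p fm set)"
    unfolding IS4_def S4I_def GS4_def GS4c_def by (rule extend_subsetI, blast)+
  show "CS4 \<subseteq> (logic_of \<Lambda> :: 'p fm set)" "DP \<subseteq> (logic_of \<Lambda> :: 'p fm set)"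
    "N \<subseteq> (logic_of \<Lambda> :: 'p fm set)"
    "\<Lambda> \<noteq> Name_S4I \<Longrightarrow> FS2 \<subseteq> (logic_of \<Lambda> :: 'p fm set)"
    "\<Lambda> = Name_S4I \<or> \<Lambda> = Name_GS4c \<Longrightarrow> CD \<subseteq> (logic_of \<Lambda> :: 'p fm set)"
    "\<Lambda> = Name_GS4 \<or> \<Lambda> = Name_GS4c \<Longrightarrow> GD \<subseteq> (logic_of \<Lambda> :: 'p fm set)"
    using IS4 S4I GS4 GS4c by (cases \<Lambda>; simp; blast)+
qed

lemma modal_logic_logic_of: "modal_logic (logic_of \<Lambda> :: ('p :: infinite) fm set)"
proof
  have "IPC \<subseteq> (CS4 :: 'p fm set)" "CS4_axioms \<subseteq> (CS4 :: 'p fm set)"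
    unfolding CS4_def by (rule extend_base extend_axioms)+
  then show "IPC \<subseteq> (logic_of \<Lambda> :: 'p fm set)" "CS4_axioms \<subseteq> (logic_of \<Lambda> :: 'p fm set)"
    using CS4_subset_logic_of by blast+
qed (rule logic_of_closed DP_subset_logic_of N_subset_logic_of)+

lemma completeness:
  fixes \<Gamma> :: "('p :: infinite) fm set"
  assumes "large_universe TYPE('p) TYPE('w)" "sem_conseq TYPE('w) \<Lambda> \<Gamma> \<phi>"
  shows "syn_conseq \<Lambda> \<Gamma> \<phi>"
proof (rule ccontr)
  interpret modal_logic "logic_of \<Lambda> :: 'p fm set"
    by (rule modal_logic_logic_of)
  assume "\<not> syn_conseq \<Lambda> \<Gamma> \<phi>"
  then have "\<not> derives \<Gamma> b" if "b \<in> {\<phi>}" for b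
    using that derives_Conj[of \<Gamma> b] unfolding syn_conseq_def by blast
  then obtain T where T: "prime_theory T" "\<Gamma> \<subseteq> T" "T \<inter> {\<phi>} = {}"
    using prime_extension[OF up_directed_singleton] by metis
  obtain f :: "'p fm set \<Rightarrow> 'w" where f: "inj f"
    using assms(1) unfolding large_universe_def by blast
  have frame: "frame_for \<Lambda> (canonical_frame f)"
    using bi_intuitionistic_canonical[OF f] infallible_canonical[OF f] forth_up_canonical[OF f]
      back_up_canonical[OF f FS2_subset_logic_of] forth_down_canonical[OF f CD_subset_logic_of]
      upward_linear_canonical[OF f GD_subset_logic_of]
    by (cases \<Lambda>) (simp_all add: IS4_frame_def S4I_frame_def GS4_frame_def GS4c_frame_def)
  \<comment> \<open>CD covers \<open>Name_S4I\<close>, and FS2 covers the other three.\<close>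
  have "FS2 \<subseteq> (logic_of \<Lambda> :: 'p fm set) \<or> CD \<subseteq> (logic_of \<Lambda> :: 'p fm set)"
    using FS2_subset_logic_of CD_subset_logic_of by blast
  note truth = truth[OF f this T(1)]
  have "f T \<in> worlds (canonical_frame f) - fallible (canonical_frame f)"
    using T(1) by (simp add: worlds_canonical[OF f] fallible_canonical[OF f])
  moreover have "\<forall>\<psi>\<in>\<Gamma>. sat (canonical_frame f) (canonical_valuation f) (f T) \<psi>"
    using truth T(2) by blast
  ultimately have "sat (canonical_frame f) (canonical_valuation f) (f T) \<phi>"
    using assms(2) frame valuation_canonical[OF f] unfolding sem_conseq_def by blast
  then show False
    using truth T(3) by blast
qed

text \<open>The type \<open>'w\<close> is arbitrary. Soundness concerns every such type, whereas
  completeness needs room for an injective copy of the prime theories.\<close>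

theorem mainTheorem6:
  fixes \<Lambda> :: logic_name
    and \<Gamma> :: "('p :: {countable, infinite}) fm set"
    and \<phi> :: "'p fm"
  shows "(syn_conseq \<Lambda> \<Gamma> \<phi> \<longrightarrow> sem_conseq TYPE('w) \<Lambda> \<Gamma> \<phi>) \<and>
    (large_universe TYPE('p) TYPE('w) \<longrightarrow>
       (sem_conseq TYPE('w) \<Lambda> \<Gamma> \<phi> \<longleftrightarrow> syn_conseq \<Lambda> \<Gamma> \<phi>))"
  using soundness completeness by blast

end
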